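(* For every fixed integer $d\ge 2$, asymptotically almost surely the homology $H_d(S_d(n,1);\mathbb Q)$ has dimension $o(n^d)$. That is, for every $\delta>0$, $$\Pr\left[\dim_{\mathbb Q} H_d(S_d(n,1);\mathbb Q)>\delta n^d\right]\longrightarrow 0\quad\text{as } n\to\infty .$$
   Context: $S_d(n,1)$ (the random $1$-out $d$-complex) is the random $d$-dimensional simplicial complex on the vertex set $[n]=\{1,\dots,n\}$ defined as follows. It has a full $(d-1)$-skeleton, i.e. it contains every nonempty subset of $[n]$ of size at most $d$. Each $(d-1)$-face $\tau$ (subset of $[n]$ of size $d$), independently of the others, chooses a uniformly random vertex $v_\tau\in[n]\setminus\tau$, and the $d$-faces of the complex are the sets $\tau\cup\{v_\tau\}$; a $d$-face chosen more than once is counted only once. A property holds asymptotically almost surely if its probability tends to $1$ as $n\to\infty$. *)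

theory Defs
  imports
    "HOL-Probability.Probability"
    "HOL-Library.Poly_Mapping"
    "HOL-Algebra.AbelCoset"
    "Jordan_Normal_Form.VS_Connect"
begin

section \<open>Quotient modules\<close>

text \<open>
  The components \<open>mult\<close> and \<open>one\<close> of the record carry no meaning for a module. The product of a
  scalar \<open>r\<close> with the coset of \<open>x\<close> is the coset of \<open>r x\<close>; the union runs over all representatives
  and has a single distinct member when \<open>N\<close> is a submodule. (The plain image of a coset under
  multiplication by \<open>r\<close> would be wrong for \<open>r = 0\<close>.)
\<close>

definition module_quotient :: "('r, 'a, 'm) module_scheme \<Rightarrow> 'a set \<Rightarrow> ('r, 'a set) module" where
  "module_quotient M N =
     \<lparr>carrier = a_rcosets\<^bsub>M\<^esub> N, mult = undefined, one = undefined, zero = N,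
      add = (<+>\<^bsub>M\<^esub>), smult = (\<lambda>r X. \<Union>x\<in>X. N +>\<^bsub>M\<^esub> (r \<odot>\<^bsub>M\<^esub> x))\<rparr>"


section \<open>Simplicial homology with rational coefficients\<close>

text \<open>
  An abstract simplicial complex is represented by its set of nonempty finite faces. Vertices are
  linearly ordered, and each face is oriented by the increasing order of its vertices. A chain is a
  finitely supported rational combination of faces.
\<close>

definition faces :: "'v set set \<Rightarrow> nat \<Rightarrow> 'v set set" where
  "faces K k = {\<sigma> \<in> K. card \<sigma> = k + 1}"

definition chains :: "'v set set \<Rightarrow> nat \<Rightarrow> ('v set \<Rightarrow>\<^sub>0 rat) set" where
  "chains K k = {c. Poly_Mapping.keys c \<subseteq> faces K k}"

definition chain_module :: "'v set set \<Rightarrow> nat \<Rightarrow> (rat, 'v set \<Rightarrow>\<^sub>0 rat) module" where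
  "chain_module K k =
     \<lparr>carrier = chains K k, mult = undefined, one = undefined, zero = 0, add = (+),
      smult = (\<lambda>r. Poly_Mapping.map ((*) r))\<rparr>"

text \<open>
  On the face with vertices \<open>v\<^sub>0 < \<dots> < v\<^sub>k\<close> the boundary is the alternating sum, with signs
  \<open>(-1)\<^sup>i\<close>, of the faces omitting \<open>v\<^sub>i\<close>; the exponent below is the index of \<open>v\<close> in \<open>\<sigma>\<close>.
  The homology is unreduced: the boundary of a 0-chain is zero.
\<close>

definition boundary :: "nat \<Rightarrow> ('v::linorder set \<Rightarrow>\<^sub>0 rat) \<Rightarrow> ('v set \<Rightarrow>\<^sub>0 rat)" where
  "boundary k c =
     (if k = 0 then 0
      else \<Sum>\<sigma>\<in>Poly_Mapping.keys c. \<Sum>v\<in>\<sigma>.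
             Poly_Mapping.single (\<sigma> - {v})
               (Poly_Mapping.lookup c \<sigma> * (-1) ^ card {u \<in> \<sigma>. u < v}))"

definition cycles :: "'v::linorder set set \<Rightarrow> nat \<Rightarrow> ('v set \<Rightarrow>\<^sub>0 rat) set" where
  "cycles K k = {c \<in> chains K k. boundary k c = 0}"

definition boundaries :: "'v::linorder set set \<Rightarrow> nat \<Rightarrow> ('v set \<Rightarrow>\<^sub>0 rat) set" where
  "boundaries K k = boundary (k + 1) ` chains K (k + 1)"

definition homology :: "nat \<Rightarrow> 'v::linorder set set \<Rightarrow> (rat, ('v set \<Rightarrow>\<^sub>0 rat) set) module" where
  "homology k K =
     module_quotient ((chain_module K k)\<lparr>carrier := cycles K k\<rparr>) (boundaries K k)"

definition homology_dim :: "nat \<Rightarrow> 'v::linorder set set \<Rightarrow> nat" where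
  "homology_dim k K = vectorspace.dim class_ring (homology k K)"


section \<open>The random 1-out complex\<close>

definition one_out_complex :: "nat \<Rightarrow> nat \<Rightarrow> (nat set \<Rightarrow> nat) \<Rightarrow> nat set set" where
  "one_out_complex d n v =
     {\<sigma>. \<sigma> \<subseteq> {1..n} \<and> \<sigma> \<noteq> {} \<and> card \<sigma> \<le> d} \<union>
     {insert (v \<tau>) \<tau> |\<tau>. \<tau> \<subseteq> {1..n} \<and> card \<tau> = d}"

text \<open>
  \<open>Pi_pmf\<close> is the law of a family of independent choices indexed by the \<open>d\<close>-subsets of \<open>{1..n}\<close>;
  its default value \<open>0\<close> outside this index set is never used. For \<open>n = d\<close> there is no vertex to
  choose from, and the law is unspecified; this does not affect limits as \<open>n\<close> grows.
\<close>

definition random_one_out_complex :: "nat \<Rightarrow> nat \<Rightarrow> nat set set pmf" where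
  "random_one_out_complex d n =
     map_pmf (one_out_complex d n)
       (Pi_pmf {\<tau>. \<tau> \<subseteq> {1..n} \<and> card \<tau> = d} 0 (\<lambda>\<tau>. pmf_of_set ({1..n} - \<tau>)))"

end

theory Submission
  imports Defs "Jordan_Normal_Form.Schur_Decomposition" "HOL-Real_Asymp.Real_Asymp"
begin

text \<open>
  Each \<open>(d-1)\<close>-face \<open>\<tau>\<close> owns the column of its \<open>d\<close>-face \<open>\<tau> \<union> {v \<tau>}\<close>, so the boundary operator
  becomes a square \<open>N \<times> N\<close> matrix \<open>A\<close>, \<open>N = n choose d\<close>, with entries \<open>\<plusminus>1\<close> on the diagonal, whose kernel
  contains the \<open>d\<close>-cycles. Let \<open>D\<close> be the diagonal matrix of row degrees and
  \<open>X = 1 - A\<^sup>T D\<^sup>-\<^sup>1 A / (d + 1)\<close>, which has spectrum in \<open>[0, 1]\<close> and fixes the kernel of \<open>A\<close>; thus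
  the dimension of the kernel is at most the trace of \<open>X\<^sup>k\<close> for every even \<open>k\<close>.

  This trace is a sum over closed walks of columns. A walk in which every new column brings a new
  vertex is tree-like, and its weight does not depend on the signs of the entries of \<open>A\<close>. The walks
  violating this number only \<open>O(n\<^sup>d\<^sup>-\<^sup>1)\<close> in expectation, for \<open>d\<close> and \<open>k\<close> fixed. So the signs may be
  changed at will, and, the diagonal being nonzero, they can be chosen such that
  \<open>\<bar>det A\<bar> \<ge> 1\<close>. With this choice the eigenvalues \<open>t\<close> of \<open>X\<close> satisfy
  \<open>\<Sum> - ln (1 - t) \<le> 2 N ln (d + 1)\<close>, and \<open>t\<^sup>k H\<^sub>k \<le> \<Sum>\<^sub>i\<^sub>\<le>\<^sub>k t\<^sup>i / i \<le> - ln (1 - t)\<close> with the harmonic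
  number \<open>H\<^sub>k\<close> bounds the trace of \<open>X\<^sup>k\<close> by \<open>2 N ln (d + 1) / H\<^sub>k\<close>, an arbitrarily small multiple of \<open>n\<^sup>d\<close>.
\<close>

section \<open>Traces of powers and the determinant\<close>

lemma sum_diag_mult_commute:
  fixes A B :: "'a::comm_semiring_0 mat"
  assumes "A \<in> carrier_mat n m" "B \<in> carrier_mat m n"
  shows "(\<Sum>i<n. (A * B) $$ (i, i)) = (\<Sum>i<m. (B * A) $$ (i, i))"
proof -
  have "(\<Sum>i<n. (A * B) $$ (i, i)) = (\<Sum>i<n. \<Sum>j<m. A $$ (i, j) * B $$ (j, i))"
    using assms by (intro sum.cong) (auto simp: scalar_prod_def lessThan_atLeast0)
  also have "\<dots> = (\<Sum>j<m. \<Sum>i<n. B $$ (j, i) * A $$ (i, j))"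
    by (subst sum.swap) (simp add: mult.commute)
  also have "\<dots> = (\<Sum>i<m. (B * A) $$ (i, i))"
    using assms by (intro sum.cong) (auto simp: scalar_prod_def lessThan_atLeast0)
  finally show ?thesis .
qed

lemma upper_triangular_pow:
  fixes A :: "'a::comm_ring_1 mat"
  assumes "A \<in> carrier_mat n n" "upper_triangular A"
  shows "upper_triangular (A ^\<^sub>m k) \<and> (\<forall>i<n. (A ^\<^sub>m k) $$ (i, i) = (A $$ (i, i)) ^ k)"
proof (induction k)
  case 0
  then show ?case using assms by (auto simp: upper_triangular_def)
next
  case (Suc k)
  have P: "A ^\<^sub>m k \<in> carrier_mat n n" using assms by simp
  have P0: "(A ^\<^sub>m k) $$ (i, j) = 0" if "j < i" "i < n" for i j
    using Suc P that by (auto simp: upper_triangular_def)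
  have A0: "A $$ (i, j) = 0" if "j < i" "i < n" for i j
    using assms that by (auto simp: upper_triangular_def)
  have e: "(A ^\<^sub>m Suc k) $$ (i, j) = (\<Sum>l<n. (A ^\<^sub>m k) $$ (i, l) * A $$ (l, j))"
    if "i < n" "j < n" for i j
    using that carrier_matD[OF P] carrier_matD[OF assms(1)]
    by (auto simp: scalar_prod_def lessThan_atLeast0)
  have "(A ^\<^sub>m Suc k) $$ (i, j) = 0" if "j < i" "i < n" for i j
  proof -
    have "(A ^\<^sub>m k) $$ (i, l) * A $$ (l, j) = 0" if "l < n" for l
      using P0[of l i] A0[of j l] that \<open>j < i\<close> \<open>i < n\<close> by (cases "l < i") auto
    then show ?thesis using e that by simp
  qed
  moreover have "(A ^\<^sub>m Suc k) $$ (i, i) = (A $$ (i, i)) ^ Suc k" if "i < n" for i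
  proof -
    have "(A ^\<^sub>m k) $$ (i, l) * A $$ (l, i) = 0" if "l < n" "l \<noteq> i" for l
      using P0[of l i] A0[of i l] that \<open>i < n\<close> by (cases "l < i") auto
    then have "(\<Sum>l<n. (A ^\<^sub>m k) $$ (i, l) * A $$ (l, i))
        = (\<Sum>l<n. if l = i then (A ^\<^sub>m k) $$ (i, i) * A $$ (i, i) else 0)"
      by (intro sum.cong) auto
    then show ?thesis using e[of i i] that Suc by (simp add: mult.commute)
  qed
  ultimately show ?case using P assms by (auto simp: upper_triangular_def)
qed

text \<open>Schur triangularisation \<open>A = P B Q\<close> with \<open>Q P = 1\<close> and the
  eigenvalues on the diagonal of \<open>B\<close>: the trace is cyclic, so the powers of
  \<open>A\<close> and \<open>B\<close> have equal traces, and those of a triangular matrix are read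
  off from the powers of its diagonal entries.\<close>

lemma trace_power_eq_sum_eigenvalues:
  fixes A :: "complex mat"
  assumes "A \<in> carrier_mat n n" "char_poly A = (\<Prod>a\<leftarrow>es. [:- a, 1:])"
  shows "(\<Sum>i<n. (A ^\<^sub>m k) $$ (i, i)) = (\<Sum>a\<leftarrow>es. a ^ k)"
proof -
  obtain B P Q where s: "schur_decomposition A es = (B, P, Q)"
    by (metis prod_cases3)
  have w: "similar_mat_wit A B P Q" and u: "upper_triangular B" and d: "diag_mat B = es"
    using schur_decomposition[OF assms s] by auto
  note c = similar_mat_witD2[OF assms(1) w]
  have "(\<Sum>i<n. (A ^\<^sub>m k) $$ (i, i)) = (\<Sum>i<n. (P * (B ^\<^sub>m k * Q)) $$ (i, i))"
    using similar_mat_wit_pow_id[OF w, of k] c by (simp add: assoc_mult_mat[of _ n n _ n _ n])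
  also have "\<dots> = (\<Sum>i<n. ((B ^\<^sub>m k * Q) * P) $$ (i, i))"
    by (rule sum_diag_mult_commute) (use c in auto)
  also have "(B ^\<^sub>m k * Q) * P = B ^\<^sub>m k"
    using c by (simp add: assoc_mult_mat[of _ n n _ n _ n])
  also have "(\<Sum>i<n. (B ^\<^sub>m k) $$ (i, i)) = (\<Sum>i<n. (B $$ (i, i)) ^ k)"
    using upper_triangular_pow[OF _ u, of n k] c by auto
  also have "\<dots> = (\<Sum>a\<leftarrow>es. a ^ k)"
    using c d[symmetric] by (simp add: diag_mat_def sum_list_sum_nth lessThan_atLeast0)
  finally show ?thesis .
qed

text \<open>The left side is a partial sum of the power series of the right side. The difference
  vanishes at 0 and has the derivative \<open>t ^ k / (1 - t)\<close>, which is nonnegative on [0,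
  1).\<close>

lemma sum_power_divide_le_ln:
  fixes x :: real
  assumes "0 \<le> x" "x < 1"
  shows "(\<Sum>i=1..k. x ^ i / real i) \<le> - ln (1 - x)"
proof -
  define f where "f = (\<lambda>t::real. - ln (1 - t) - (\<Sum>i=1..k. t ^ i / real i))"
  have "f 0 \<le> f x"
  proof (rule DERIV_nonneg_imp_nondecreasing[OF assms(1)])
    fix t :: real assume t: "0 \<le> t" "t \<le> x"
    have "(\<Sum>i=1..k. real i * t ^ (i - 1) / real i) = (\<Sum>i=1..k. t ^ (i - 1))"
      by (intro sum.cong) auto
    also have "\<dots> = (\<Sum>i<k. t ^ i)"
      by (rule sum.reindex_bij_witness[of _ Suc "\<lambda>i. i - 1"]) auto
    also have "\<dots> = (1 - t ^ k) / (1 - t)"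
      using t assms by (subst sum_gp_strict) auto
    finally have s: "(\<Sum>i=1..k. real i * t ^ (i - 1) / real i) = (1 - t ^ k) / (1 - t)" .
    have "(f has_real_derivative
        1 / (1 - t) - (\<Sum>i=1..k. real i * t ^ (i - 1) / real i)) (at t)"
      unfolding f_def using t assms
      by (auto intro!: derivative_eq_intros simp: field_simps)
    moreover have "1 / (1 - t) - (1 - t ^ k) / (1 - t) \<ge> 0"
      using t assms by (simp add: diff_divide_distrib[symmetric])
    ultimately show "\<exists>y. (f has_real_derivative y) (at t) \<and> y \<ge> 0"
      unfolding s by blast
  qed
  moreover have "(\<Sum>i=1..k. (0::real) ^ i / real i) = 0"
    by (intro sum.neutral) auto
  ultimately show ?thesis by (simp add: f_def)
qed

lemma power_mult_harm_le_ln: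
  fixes x :: real
  assumes "0 \<le> x" "x < 1"
  shows "x ^ k * harm k \<le> - ln (1 - x)"
proof -
  have "x ^ k * harm k = (\<Sum>i=1..k. x ^ k / real i)"
    by (simp add: harm_def sum_distrib_left divide_inverse)
  also have "\<dots> \<le> (\<Sum>i=1..k. x ^ i / real i)"
    using assms by (intro sum_mono divide_right_mono power_decreasing) auto
  finally show ?thesis using sum_power_divide_le_ln[OF assms] by (rule order_trans)
qed

text \<open>The scalar inequality is summed over the spectrum: the powers add up to the trace, and
  the logarithms to that of the determinant of \<open>1 - X\<close>. The nonzero determinant
  excludes the eigenvalue 1, where the logarithm would break down. The spectrum is described over
  the complex numbers because the characteristic polynomial splits there.\<close>

lemma trace_power_mult_harm_le:
  fixes X :: "real mat"
  assumes X: "X \<in> carrier_mat n n"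
    and det: "det (1\<^sub>m n - X) \<noteq> 0"
    and ev: "\<And>w c. eigenvector (map_mat complex_of_real X) w c \<Longrightarrow> \<exists>t\<in>{0..1}. c = of_real t"
  shows "(\<Sum>i<n. (X ^\<^sub>m k) $$ (i, i)) * harm k \<le> - ln (det (1\<^sub>m n - X))"
proof -
  define C where "C = map_mat complex_of_real X"
  have C: "C \<in> carrier_mat n n" using X by (simp add: C_def)
  obtain bs where bs: "char_poly C = (\<Prod>a\<leftarrow>bs. [:- a, 1:])"
    using char_poly_factorized[OF C] by blast
  define ts where "ts = map Re bs"
  have ts: "\<exists>t\<in>{0..1}. b = complex_of_real t" if "b \<in> set bs" for b
  proof -
    have "poly (char_poly C) b = 0"
      unfolding bs using that by (simp add: poly_prod_list prod_list_zero_iff)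
    then obtain w where "eigenvector C w b"
      using eigenvalue_root_char_poly[OF C] by (auto simp: eigenvalue_def)
    then show ?thesis using ev unfolding C_def by blast
  qed
  \<comment> \<open>By \<open>ev\<close> all roots are real, so trace and determinant can be
    expressed through the real list \<open>ts\<close>.\<close>
  have "map (complex_of_real \<circ> Re) bs = bs"
    using ts by (intro map_idI) fastforce
  then have bt: "bs = map complex_of_real ts"
    by (simp add: ts_def)
  have "complex_of_real (\<Sum>i<n. (X ^\<^sub>m k) $$ (i, i)) = (\<Sum>i<n. (C ^\<^sub>m k) $$ (i, i))"
    using X by (simp add: C_def of_real_hom.mat_hom_pow[OF X, symmetric])
  also have "\<dots> = (\<Sum>a\<leftarrow>bs. a ^ k)"
    by (rule trace_power_eq_sum_eigenvalues[OF C bs])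
  also have "\<dots> = complex_of_real (\<Sum>t\<leftarrow>ts. t ^ k)"
    unfolding bt by (induction ts) auto
  finally have tr: "(\<Sum>i<n. (X ^\<^sub>m k) $$ (i, i)) = (\<Sum>t\<leftarrow>ts. t ^ k)"
    by (simp only: of_real_eq_iff)
  have "complex_of_real (det (1\<^sub>m n - X)) = det (- char_matrix C 1)"
  proof -
    have "- char_matrix C 1 = map_mat complex_of_real (1\<^sub>m n - X)"
      using X by (intro eq_matI) (auto simp: C_def char_matrix_def)
    then show ?thesis by simp
  qed
  also have "\<dots> = poly (char_poly C) 1"
    by (rule char_poly_matrix[OF C, symmetric])
  also have "\<dots> = (\<Prod>b\<leftarrow>bs. 1 - b)"
    unfolding bs by (simp add: poly_prod_list o_def)
  also have "\<dots> = complex_of_real (\<Prod>t\<leftarrow>ts. 1 - t)"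
    unfolding bt by (induction ts) auto
  finally have dt: "det (1\<^sub>m n - X) = (\<Prod>t\<leftarrow>ts. 1 - t)"
    by (simp only: of_real_eq_iff)
  have t01: "0 \<le> t \<and> t < 1" if "t \<in> set ts" for t
  proof -
    have "t \<noteq> 1" using dt det that by (auto simp: prod_list_zero_iff)
    then show ?thesis using ts that unfolding ts_def by fastforce
  qed
  then have "(\<Sum>t\<leftarrow>ts. t ^ k) * harm k \<le> (\<Sum>t\<leftarrow>ts. - ln (1 - t))"
    using power_mult_harm_le_ln
    by (simp add: sum_list_mult_const[symmetric] sum_list_mono)
  \<comment> \<open>Positivity of the product is carried through the induction, since splitting the
    logarithm of a product needs it for the tail.\<close>
  also have "(\<Sum>t\<leftarrow>ts. - ln (1 - t)) = - ln (\<Prod>t\<leftarrow>ts. 1 - t) \<and> (\<Prod>t\<leftarrow>ts. 1 - t) > 0"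
    using t01 by (induction ts) (auto simp: ln_mult_pos)
  then have "(\<Sum>t\<leftarrow>ts. - ln (1 - t)) = - ln (\<Prod>t\<leftarrow>ts. 1 - t)" ..
  finally show ?thesis unfolding tr dt .
qed


section \<open>Signs that make the determinant large\<close>

text \<open>Expansion along row \<open>p\<close>: deleting this row removes the only difference
  between \<open>A\<close> and \<open>B\<close>, so both have the same cofactors there.\<close>

lemma det_update_entry:
  fixes A :: "'a::comm_ring_1 mat"
  assumes A: "A \<in> carrier_mat n n" and B: "B \<in> carrier_mat n n"
    and pq: "p < n" "q < n"
    and eq: "\<And>i j. i < n \<Longrightarrow> j < n \<Longrightarrow> (i, j) \<noteq> (p, q) \<Longrightarrow> B $$ (i, j) = A $$ (i, j)"
  shows "det B = det A + (B $$ (p, q) - A $$ (p, q)) * cofactor A p q"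
proof -
  have c: "cofactor B p j = cofactor A p j" if "j < n" for j
  proof -
    have "mat_delete B p j = mat_delete A p j"
      using A B pq that by (intro eq_matI) (auto simp: mat_delete_def intro!: eq)
    then show ?thesis by (simp add: cofactor_def)
  qed
  have "det B = (\<Sum>j<n. B $$ (p, j) * cofactor B p j)"
    by (rule laplace_expansion_row[OF B pq(1)])
  also have "\<dots> = (\<Sum>j<n. A $$ (p, j) * cofactor A p j
      + (if j = q then (B $$ (p, q) - A $$ (p, q)) * cofactor A p q else 0))"
    using pq by (intro sum.cong) (auto simp: c eq algebra_simps)
  also have "\<dots> = (\<Sum>j<n. A $$ (p, j) * cofactor A p j)
      + (B $$ (p, q) - A $$ (p, q)) * cofactor A p q"
    using pq by (simp add: sum.distrib)
  also have "(\<Sum>j<n. A $$ (p, j) * cofactor A p j) = det A"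
    by (rule laplace_expansion_row[OF A pq(1), symmetric])
  finally show ?thesis .
qed

text \<open>
  The determinant is affine in each entry, so for one of the two signs it does not get smaller in
  absolute value when an off-diagonal entry is switched on.
\<close>

lemma exists_signs_abs_det_ge_1:
  fixes a :: "nat \<Rightarrow> nat \<Rightarrow> real"
  assumes diag: "\<And>i. i < n \<Longrightarrow> \<bar>a i i\<bar> = 1"
  shows "\<exists>s. (\<forall>i j. s i j \<in> {-1, 1}) \<and> \<bar>det (mat n n (\<lambda>(i, j). s i j * a i j))\<bar> \<ge> 1"
proof -
  \<comment> \<open>\<open>F\<close> holds the off-diagonal positions switched on so far. The
    induction leads from the diagonal matrix, whose determinant is a product of entries
    \<plusminus>1, to the full matrix.\<close>
  define D where "D = (\<lambda>F s. mat n n (\<lambda>(i, j). if i = j \<or> (i, j) \<in> F then s i j * a i j else 0))"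
  have "\<exists>s. (\<forall>i j. s i j \<in> {-1, 1}) \<and> \<bar>det (D F s)\<bar> \<ge> 1" if "finite F" for F
    using that
  proof (induction F)
    case empty
    have "det (D {} (\<lambda>_ _. 1)) = prod_list (diag_mat (D {} (\<lambda>_ _. 1)))"
      by (rule det_upper_triangular[where n = n]) (auto simp: D_def upper_triangular_def)
    also have "\<dots> = (\<Prod>i<n. a i i)"
      by (simp add: D_def diag_mat_def prod.list_conv_set_nth lessThan_atLeast0)
    finally have "\<bar>det (D {} (\<lambda>_ _. 1))\<bar> = 1"
      using diag by (simp add: abs_prod)
    then show ?case by (intro exI[of _ "\<lambda>_ _. 1"]) auto
  next
    case (insert x F)
    obtain p q where x: "x = (p, q)" by (cases x)
    obtain s where s: "\<forall>i j. s i j \<in> {-1, 1}" "\<bar>det (D F s)\<bar> \<ge> 1"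
      using insert by blast
    show ?case
    proof (cases "p < n \<and> q < n \<and> p \<noteq> q")
      case False
      then have "D (insert x F) s = D F s"
        unfolding D_def x by (intro eq_matI) auto
      with s show ?thesis by metis
    next
      case True
      define s' where "s' = (\<lambda>t. s(p := (s p)(q := t)))"
      \<comment> \<open>As \<open>p \<noteq> q\<close> and \<open>(p, q) \<notin> F\<close>, the old
        entry at this position is 0 and the change is exactly \<open>t * a p q\<close>. The values
        for \<open>t = 1\<close> and \<open>t = - 1\<close> have the mean
        \<open>det (D F s)\<close>.\<close>
      have d: "det (D (insert x F) (s' t)) = det (D F s) + t * (a p q * cofactor (D F s) p q)" for t
        using True insert.hyps x
        by (subst det_update_entry[of "D F s" n _ p q]) (auto simp: D_def s'_def)
      have "\<bar>det (D (insert x F) (s' 1))\<bar> \<ge> 1 \<or> \<bar>det (D (insert x F) (s' (- 1)))\<bar> \<ge> 1"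
        using s(2) unfolding d by linarith
      moreover have "\<forall>i j. s' 1 i j \<in> {-1, 1}" "\<forall>i j. s' (- 1) i j \<in> {-1, 1}"
        using s(1) by (auto simp: s'_def)
      ultimately show ?thesis by blast
    qed
  qed
  from this[of "{..<n} \<times> {..<n}"] obtain s where
    s: "\<forall>i j. s i j \<in> {-1, 1}" "\<bar>det (D ({..<n} \<times> {..<n}) s)\<bar> \<ge> 1"
    by auto
  have "D ({..<n} \<times> {..<n}) s = mat n n (\<lambda>(i, j). s i j * a i j)"
    unfolding D_def by (intro eq_matI) auto
  with s show ?thesis by auto
qed

section \<open>Matrices indexed by finite sets and the trace bound for well-chosen signs\<close>

text \<open>Matrix powers over an arbitrary index set let faces themselves serve as rows and
  columns; \<open>kpow_eq_pow_mat\<close> is the bridge to the spectral theory of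
  \<open>mat\<close>.\<close>

fun kpow :: "'a set \<Rightarrow> ('a \<Rightarrow> 'a \<Rightarrow> real) \<Rightarrow> nat \<Rightarrow> 'a \<Rightarrow> 'a \<Rightarrow> real" where
  "kpow T X 0 x y = (if x = y then 1 else 0)"
| "kpow T X (Suc k) x y = (\<Sum>z\<in>T. X x z * kpow T X k z y)"

text \<open>In matrix form \<open>1 - A^T G A\<close> with the diagonal matrix \<open>G\<close> of
  the weights \<open>g\<close>. For \<open>g r = 1 / ((d + 1) deg r)\<close> this is the matrix
  \<open>X\<close> of the proof idea.\<close>

definition cogram :: "'r set \<Rightarrow> ('r \<Rightarrow> 'c \<Rightarrow> real) \<Rightarrow> ('r \<Rightarrow> real) \<Rightarrow> 'c \<Rightarrow> 'c \<Rightarrow> real" where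
  "cogram R a g x y = (if x = y then 1 else 0) - (\<Sum>r\<in>R. g r * a r x * a r y)"

lemma kpow_Suc_right:
  assumes "finite T"
  shows "x \<in> T \<Longrightarrow> y \<in> T \<Longrightarrow> kpow T X (Suc k) x y = (\<Sum>z\<in>T. kpow T X k x z * X z y)"
proof (induction k arbitrary: x)
  case 0
  then show ?case using assms by (simp add: if_distrib[of "\<lambda>b. _ * b"] if_distrib[of "\<lambda>b. b * _"] cong: if_cong)
next
  case (Suc k)
  have "kpow T X (Suc (Suc k)) x y = (\<Sum>z\<in>T. X x z * (\<Sum>u\<in>T. kpow T X k z u * X u y))"
    unfolding kpow.simps(2)[of T X "Suc k"] using Suc by (intro sum.cong) auto
  also have "\<dots> = (\<Sum>u\<in>T. kpow T X (Suc k) x u * X u y)"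
    unfolding sum_distrib_left kpow.simps(2) sum_distrib_right
    by (subst sum.swap) (simp add: mult.assoc)
  finally show ?case .
qed

lemma kpow_eq_pow_mat:
  assumes e: "bij_betw e {..<n} T" and ij: "i < n" "j < n"
  shows "(mat n n (\<lambda>(i, j). X (e i) (e j)) ^\<^sub>m k) $$ (i, j) = kpow T X k (e i) (e j)"
  using ij
proof (induction k arbitrary: i j)
  case 0
  then show ?case using e by (auto simp: bij_betw_def inj_on_def)
next
  case (Suc k)
  let ?M = "mat n n (\<lambda>(i, j). X (e i) (e j))"
  have Mk: "?M ^\<^sub>m k \<in> carrier_mat n n" by simp
  have T: "finite T" "e i \<in> T" "e j \<in> T"
    using e Suc.prems bij_betw_finite[OF e] by (auto simp: bij_betw_def)
  have "(?M ^\<^sub>m Suc k) $$ (i, j) = (\<Sum>l<n. (?M ^\<^sub>m k) $$ (i, l) * X (e l) (e j))"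
    using Suc.prems carrier_matD[OF Mk]
    by (auto simp: scalar_prod_def lessThan_atLeast0)
  also have "\<dots> = (\<Sum>l<n. kpow T X k (e i) (e l) * X (e l) (e j))"
    using Suc by (intro sum.cong) auto
  also have "\<dots> = (\<Sum>z\<in>T. kpow T X k (e i) z * X z (e j))"
    by (rule sum.reindex_bij_betw[OF e])
  finally show ?case using kpow_Suc_right[OF T] by metis
qed

lemma kpow_add:
  assumes "finite T" "x \<in> T"
  shows "kpow T X (j + k) x y = (\<Sum>z\<in>T. kpow T X j x z * kpow T X k z y)"
  using assms(2)
proof (induction j arbitrary: x)
  case 0
  then show ?case using assms by (simp add: if_distrib[of "\<lambda>b. b * _"] cong: if_cong)
next
  case (Suc j)
  have "kpow T X (Suc j + k) x y = (\<Sum>z\<in>T. X x z * (\<Sum>u\<in>T. kpow T X j z u * kpow T X k u y))"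
    using Suc by simp
  also have "\<dots> = (\<Sum>u\<in>T. kpow T X (Suc j) x u * kpow T X k u y)"
    unfolding sum_distrib_left kpow.simps(2) sum_distrib_right
    by (subst sum.swap) (simp add: mult.assoc)
  finally show ?case .
qed

lemma kpow_sym:
  assumes "finite T" "\<And>x y. X x y = X y x"
  shows "x \<in> T \<Longrightarrow> y \<in> T \<Longrightarrow> kpow T X k x y = kpow T X k y x"
proof (induction k arbitrary: x y)
  case (Suc k)
  have "kpow T X (Suc k) x y = (\<Sum>z\<in>T. kpow T X k x z * X z y)"
    using assms Suc by (intro kpow_Suc_right)
  also have "\<dots> = (\<Sum>z\<in>T. X y z * kpow T X k z x)"
    using Suc assms(2) by (intro sum.cong) (auto simp: mult.commute)
  finally show ?case by simp
qed auto

text \<open>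
  The hypothesis \<open>contr\<close> says that the matrix of absolute values, with rows scaled by the square
  roots of the weights \<open>g\<close>, is a contraction; hence it does not see the signs.
\<close>

lemma exists_signs_trace_le:
  fixes a :: "'a \<Rightarrow> 'a \<Rightarrow> real"
  assumes T: "finite T"
    and diag: "\<And>x. x \<in> T \<Longrightarrow> \<bar>a x x\<bar> = 1"
    and g: "\<And>r. r \<in> T \<Longrightarrow> g r > 0"
    and contr: "\<And>u. (\<Sum>r\<in>T. g r * (\<Sum>x\<in>T. \<bar>a r x\<bar> * u x)\<^sup>2) \<le> (\<Sum>x\<in>T. (u x)\<^sup>2)"
  shows "\<exists>s. (\<forall>x y. s x y \<in> {-1, 1}) \<and>
    (\<Sum>x\<in>T. kpow T (cogram T (\<lambda>r x. s r x * a r x) g) k x x) * harm k \<le> (\<Sum>r\<in>T. - ln (g r))"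
proof -
  define n where "n = card T"
  obtain e where e: "bij_betw e {..<n} T"
    using ex_bij_betw_nat_finite[OF T] unfolding n_def lessThan_atLeast0 by blast
  have eT: "e i \<in> T" if "i < n" for i
    using e that by (auto simp: bij_betw_def)
  obtain s0 where s0: "\<forall>i j. s0 i j \<in> {-1, 1::real}"
    and det_s0: "\<bar>det (mat n n (\<lambda>(i, j). s0 i j * a (e i) (e j)))\<bar> \<ge> 1"
    using exists_signs_abs_det_ge_1[of n "\<lambda>i j. a (e i) (e j)"] diag eT by blast
  define f where "f = inv_into {..<n} e"
  have fe: "f (e i) = i" if "i < n" for i
    using e that by (simp add: f_def bij_betw_inv_into_left)
  define s where "s = (\<lambda>x y. s0 (f x) (f y))"
  define b where "b = (\<lambda>i j. s (e i) (e j) * a (e i) (e j))"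
  define h where "h = (\<lambda>i. g (e i))"
  have s: "s x y \<in> {-1, 1}" for x y using s0 by (auto simp: s_def)
  have abs_b: "\<bar>b i j\<bar> = \<bar>a (e i) (e j)\<bar>" for i j
    using s[of "e i" "e j"] by (auto simp: b_def abs_mult)
  let ?B = "mat n n (\<lambda>(i, j). b i j)"
  let ?X = "mat n n (\<lambda>(i, j). cogram T (\<lambda>r x. s r x * a r x) g (e i) (e j))"
  let ?G = "mat n n (\<lambda>(i, j). if i = j then h i else 0)"
  have detB: "\<bar>det ?B\<bar> \<ge> 1"
  proof -
    have "?B = mat n n (\<lambda>(i, j). s0 i j * a (e i) (e j))"
      by (intro eq_matI) (auto simp: b_def s_def fe)
    with det_s0 show ?thesis by simp
  qed
  have X: "cogram T (\<lambda>r x. s r x * a r x) g (e i) (e j)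
      = (if i = j then 1 else 0) - (\<Sum>l<n. h l * b l i * b l j)" if "i < n" "j < n" for i j
  proof -
    have "(\<Sum>r\<in>T. g r * (s r (e i) * a r (e i)) * (s r (e j) * a r (e j)))
        = (\<Sum>l<n. h l * b l i * b l j)"
      unfolding b_def h_def by (rule sum.reindex_bij_betw[OF e, symmetric])
    moreover have "e i = e j \<longleftrightarrow> i = j" using that fe by metis
    ultimately show ?thesis by (simp add: cogram_def)
  qed
  have "?G * ?B = mat n n (\<lambda>(i, j). h i * b i j)"
    by (intro eq_matI) (auto simp: scalar_prod_def if_distrib[of "\<lambda>b. b * _"] cong: if_cong)
  then have "(?B\<^sup>T * (?G * ?B)) $$ (i, j) = (\<Sum>l<n. h l * b l i * b l j)" if "i < n" "j < n" for i j
    using that by (auto simp: scalar_prod_def lessThan_atLeast0 mult_ac)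
  \<comment> \<open>This factorisation makes the determinant of \<open>1 - X\<close> equal to the
    square of \<open>det B\<close> times the product of the weights, so
    \<open>\<bar>det B\<bar> \<ge> 1\<close> bounds it from below by that product.\<close>
  then have M: "1\<^sub>m n - ?X = ?B\<^sup>T * (?G * ?B)"
    by (intro eq_matI) (auto simp: X simp del: index_mult_mat(1))
  have "det ?G = prod_list (diag_mat ?G)"
    by (rule det_upper_triangular[where n = n]) (auto simp: upper_triangular_def)
  also have "\<dots> = (\<Prod>i<n. h i)"
    by (simp add: diag_mat_def prod.list_conv_set_nth lessThan_atLeast0)
  finally have detG: "det ?G = (\<Prod>i<n. h i)" .
  have h: "h i > 0" if "i < n" for i using g eT that by (simp add: h_def)
  have detM: "det (1\<^sub>m n - ?X) = (det ?B)\<^sup>2 * (\<Prod>i<n. h i)"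
  proof -
    have "det (?B\<^sup>T * (?G * ?B)) = det (?B\<^sup>T) * det (?G * ?B)"
      by (rule det_mult[of _ n]) auto
    also have "det (?G * ?B) = det ?G * det ?B"
      by (rule det_mult[of _ n]) auto
    also have "det (?B\<^sup>T) = det ?B"
      by (rule det_transpose[of _ n]) auto
    finally show ?thesis unfolding M detG by (simp add: power2_eq_square)
  qed
  have hp: "(\<Prod>i<n. h i) > 0" using h by (intro prod_pos) auto
  have detB2: "(det ?B)\<^sup>2 \<ge> 1" using detB by (simp add: abs_le_square_iff[of 1, simplified])
  have "(\<Sum>i<n. (?X ^\<^sub>m k) $$ (i, i)) * harm k \<le> - ln (det (1\<^sub>m n - ?X))"
  proof (rule trace_power_mult_harm_le)
    show "det (1\<^sub>m n - ?X) \<noteq> 0"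
      unfolding detM using detB2 hp by (intro dual_order.strict_implies_not_eq mult_pos_pos) auto
    fix w c assume "eigenvector (map_mat complex_of_real ?X) w c"
    then have w: "w \<in> carrier_vec n" "w \<noteq> 0\<^sub>v n"
      and ew: "map_mat complex_of_real ?X *\<^sub>v w = c \<cdot>\<^sub>v w"
      by (auto simp: eigenvector_def)
    \<comment> \<open>Rayleigh quotient: \<open>W\<close> is the squared norm of the eigenvector,
      \<open>Q\<close> the weighted squared norm of its image under \<open>B\<close>. Pairing the
      eigenvalue equation with the conjugate vector gives \<open>c * W = W - Q\<close>, so
      \<open>c\<close> lies in [0, 1] once \<open>0 \<le> Q \<le> W\<close> is known.\<close>
    define u where "u = (\<lambda>i. w $ i)"
    define W where "W = (\<Sum>i<n. (cmod (u i))\<^sup>2)"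
    define Q where "Q = (\<Sum>l<n. h l * (cmod (\<Sum>j<n. b l j * u j))\<^sup>2)"
    have nsq: "(complex_of_real (cmod z))\<^sup>2 = z * cnj z" for z
      using complex_norm_square[of z] by simp
    have W: "W > 0"
    proof -
      obtain i where "i < n" "u i \<noteq> 0"
        using w unfolding u_def by (metis carrier_vecD eq_vecI index_zero_vec(1) index_zero_vec(2))
      then show ?thesis unfolding W_def by (intro sum_pos2[of _ i]) auto
    qed
    have eq: "u i - (\<Sum>j<n. \<Sum>l<n. complex_of_real (h l * b l i * b l j) * u j) = c * u i"
      if "i < n" for i
    proof -
      have "(map_mat complex_of_real ?X *\<^sub>v w) $ i
          = (\<Sum>j<n. complex_of_real ((if i = j then 1 else 0) - (\<Sum>l<n. h l * b l i * b l j)) * u j)"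
        using that w by (auto simp: scalar_prod_def lessThan_atLeast0 u_def X intro!: sum.cong)
      also have "\<dots> = (\<Sum>j<n. (if i = j then u j else 0)
          - (\<Sum>l<n. complex_of_real (h l * b l i * b l j) * u j))"
        by (intro sum.cong) (auto simp: algebra_simps sum_distrib_right sum_distrib_left)
      also have "\<dots> = u i - (\<Sum>j<n. \<Sum>l<n. complex_of_real (h l * b l i * b l j) * u j)"
        using that by (simp add: sum_subtractf)
      finally show ?thesis using ew that w by (simp add: u_def)
    qed
    have "c * W = (\<Sum>i<n. cnj (u i) * (c * u i))"
      by (simp add: W_def sum_distrib_left nsq mult_ac)
    also have "\<dots> = (\<Sum>i<n. cnj (u i) * u i)
        - (\<Sum>i<n. \<Sum>j<n. \<Sum>l<n. cnj (u i) * (complex_of_real (h l * b l i * b l j) * u j))"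
      by (simp add: eq[symmetric] algebra_simps sum_subtractf sum_distrib_left)
    also have "(\<Sum>i<n. cnj (u i) * u i) = W"
      by (simp add: W_def nsq mult_ac)
    also have "(\<Sum>i<n. \<Sum>j<n. \<Sum>l<n. cnj (u i) * (complex_of_real (h l * b l i * b l j) * u j))
        = (\<Sum>l<n. h l * ((\<Sum>i<n. b l i * cnj (u i)) * (\<Sum>j<n. b l j * u j)))"
      (is "(\<Sum>i<n. \<Sum>j<n. \<Sum>l<n. ?F i j l) = _")
    proof -
      have "(\<Sum>i<n. \<Sum>j<n. \<Sum>l<n. ?F i j l) = (\<Sum>i<n. \<Sum>l<n. \<Sum>j<n. ?F i j l)"
        by (intro sum.cong refl sum.swap)
      also have "\<dots> = (\<Sum>l<n. \<Sum>i<n. \<Sum>j<n. ?F i j l)"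
        by (rule sum.swap)
      finally show ?thesis
        by (simp only: sum_product) (simp add: sum_distrib_left mult_ac)
    qed
    also have "\<dots> = complex_of_real Q"
    proof -
      have "(\<Sum>i<n. b l i * cnj (u i)) = cnj (\<Sum>j<n. b l j * u j)" for l by simp
      then show ?thesis by (simp add: Q_def nsq mult_ac)
    qed
    finally have c: "c * W = of_real (W - Q)" by simp
    have Q0: "Q \<ge> 0" unfolding Q_def by (intro sum_nonneg mult_nonneg_nonneg) (auto simp: h less_imp_le)
    \<comment> \<open>The triangle inequality discards signs and phases; then \<open>contr\<close>
      applies to the vector of moduli.\<close>
    have "Q \<le> (\<Sum>l<n. h l * (\<Sum>j<n. \<bar>b l j\<bar> * cmod (u j))\<^sup>2)"
      unfolding Q_def
      by (intro sum_mono mult_left_mono power_mono order_trans[OF norm_sum])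
        (auto simp: norm_mult h less_imp_le)
    also have "\<dots> = (\<Sum>r\<in>T. g r * (\<Sum>x\<in>T. \<bar>a r x\<bar> * cmod (u (f x)))\<^sup>2)"
    proof -
      have "(\<Sum>j<n. \<bar>b l j\<bar> * cmod (u j)) = (\<Sum>x\<in>T. \<bar>a (e l) x\<bar> * cmod (u (f x)))" for l
        by (subst sum.reindex_bij_betw[OF e, symmetric]) (auto simp: abs_b fe)
      then show ?thesis
        unfolding h_def by (subst sum.reindex_bij_betw[OF e, symmetric]) simp
    qed
    also have "\<dots> \<le> (\<Sum>x\<in>T. (cmod (u (f x)))\<^sup>2)" by (rule contr)
    also have "\<dots> = W"
      unfolding W_def by (subst sum.reindex_bij_betw[OF e, symmetric]) (auto simp: fe)
    finally have QW: "Q \<le> W" .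
    have "c = of_real ((W - Q) / W)" using c W by (simp add: field_simps)
    then show "\<exists>t\<in>{0..1}. c = complex_of_real t"
      using Q0 QW W by (intro bexI[of _ "(W - Q) / W"]) auto
  qed simp
  also have "- ln (det (1\<^sub>m n - ?X)) \<le> (\<Sum>i<n. - ln (h i))"
  proof -
    have "ln ((det ?B)\<^sup>2 * (\<Prod>i<n. h i)) = ln ((det ?B)\<^sup>2) + ln (\<Prod>i<n. h i)"
      using detB2 hp by (intro ln_mult_pos) auto
    moreover have "ln ((det ?B)\<^sup>2) \<ge> 0" using detB2 by (rule ln_ge_zero)
    moreover have "ln (\<Prod>i<n. h i) = (\<Sum>i<n. ln (h i))"
      by (intro ln_prod) (auto dest: h)
    ultimately show ?thesis unfolding detM by (simp add: sum_negf)
  qed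
  also have "\<dots> = (\<Sum>r\<in>T. - ln (g r))"
    unfolding h_def by (rule sum.reindex_bij_betw[OF e])
  also have "(\<Sum>i<n. (?X ^\<^sub>m k) $$ (i, i)) = (\<Sum>x\<in>T. kpow T (cogram T (\<lambda>r x. s r x * a r x) g) k x x)"
    by (subst sum.reindex_bij_betw[OF e, symmetric]) (simp add: kpow_eq_pow_mat[OF e])
  finally show ?thesis using s by blast
qed

section \<open>Closed walks of columns\<close>

fun path_weight :: "('a \<Rightarrow> 'a \<Rightarrow> real) \<Rightarrow> 'a list \<Rightarrow> real" where
  "path_weight X (x # y # zs) = X x y * path_weight X (y # zs)"
| "path_weight X _ = 1"

lemma kpow_eq_sum_path_weight:
  assumes T: "finite T" "y \<in> T"
  shows "kpow T X (Suc k) x y = (\<Sum>zs | set zs \<subseteq> T \<and> length zs = k. path_weight X (x # zs @ [y]))"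
proof (induction k arbitrary: x)
  case 0
  have "{zs. set zs \<subseteq> T \<and> length zs = 0} = {[]}" by auto
  then show ?case using T by (simp add: if_distrib[of "\<lambda>b. _ * b"] cong: if_cong)
next
  case (Suc k)
  let ?L = "\<lambda>k. {zs. set zs \<subseteq> T \<and> length zs = k}"
  have "(\<Sum>zs\<in>?L (Suc k). path_weight X (x # zs @ [y]))
      = (\<Sum>(zs, z)\<in>?L k \<times> T. path_weight X (x # z # zs @ [y]))"
    unfolding lists_length_Suc_eq
    by (subst sum.reindex) (auto simp: inj_on_def case_prod_unfold)
  also have "\<dots> = (\<Sum>z\<in>T. \<Sum>zs\<in>?L k. X x z * path_weight X (z # zs @ [y]))"
    by (simp add: sum.cartesian_product[symmetric]) (rule sum.swap)
  also have "\<dots> = (\<Sum>z\<in>T. X x z * kpow T X (Suc k) z y)"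
    by (simp only: Suc sum_distrib_left)
  finally show ?case by simp
qed

text \<open>A closed walk of \<open>Suc k\<close> steps is recorded by the list of its
  \<open>Suc k\<close> columns; appending \<open>hd ts\<close> restores the closing step.\<close>

lemma trace_eq_sum_path_weight:
  assumes T: "finite T"
  shows "(\<Sum>x\<in>T. kpow T X (Suc k) x x)
    = (\<Sum>ts | set ts \<subseteq> T \<and> length ts = Suc k. path_weight X (ts @ [hd ts]))"
proof -
  let ?L = "\<lambda>k. {zs. set zs \<subseteq> T \<and> length zs = k}"
  have "(\<Sum>ts\<in>?L (Suc k). path_weight X (ts @ [hd ts]))
      = (\<Sum>(zs, z)\<in>?L k \<times> T. path_weight X (z # zs @ [z]))"
    unfolding lists_length_Suc_eq
    by (subst sum.reindex) (auto simp: inj_on_def case_prod_unfold)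
  also have "\<dots> = (\<Sum>z\<in>T. \<Sum>zs\<in>?L k. path_weight X (z # zs @ [z]))"
    by (simp add: sum.cartesian_product[symmetric]) (rule sum.swap)
  finally show ?thesis by (simp only: kpow_eq_sum_path_weight[OF T] cong: sum.cong)
qed

lemma abs_path_weight_le_1:
  assumes "\<And>x y. x \<in> set xs \<Longrightarrow> y \<in> set xs \<Longrightarrow> \<bar>X x y\<bar> \<le> 1"
  shows "\<bar>path_weight X xs\<bar> \<le> 1"
  using assms
proof (induction X xs rule: path_weight.induct)
  case (1 X x y zs)
  have "\<bar>X x y\<bar> * \<bar>path_weight X (y # zs)\<bar> \<le> 1 * 1"
    using 1 by (intro mult_mono) auto
  then show ?case by (simp add: abs_mult)
qed auto

text \<open>The sign of an inner column occurs in two consecutive factors and cancels. The signs of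
  the two ends remain, and these coincide for a closed walk.\<close>

lemma path_weight_gauge:
  assumes "xs \<noteq> []" "\<And>x. x \<in> set xs \<Longrightarrow> \<epsilon> x \<in> {-1, 1}"
    "\<And>x y. x \<in> set xs \<Longrightarrow> y \<in> set xs \<Longrightarrow> Y x y = \<epsilon> x * \<epsilon> y * X x y"
  shows "path_weight Y xs = \<epsilon> (hd xs) * \<epsilon> (last xs) * path_weight X xs"
  using assms
proof (induction X xs rule: path_weight.induct)
  case (1 X x y zs)
  have "path_weight Y (y # zs) = \<epsilon> y * \<epsilon> (last (y # zs)) * path_weight X (y # zs)"
    using 1 by force
  moreover have "\<epsilon> y * \<epsilon> y = 1" using 1(3)[of y] by auto
  ultimately show ?case using 1(4)[of x y] by (simp add: algebra_simps)
next
  case ("2_2" X x)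
  then show ?case using "2_2"(2)[of x] by auto
qed auto

lemma successively_if_path_weight_nonzero:
  "path_weight X xs \<noteq> 0 \<Longrightarrow> (\<And>x y. x \<in> set xs \<Longrightarrow> y \<in> set xs \<Longrightarrow> X x y \<noteq> 0 \<Longrightarrow> P x y)
    \<Longrightarrow> successively P xs"
  by (induction X xs rule: path_weight.induct) auto

text \<open>
  Lists are read from right to left here: the tail consists of the earlier columns of a walk.
\<close>

fun stale :: "('c \<Rightarrow> 'v set) \<Rightarrow> 'c list \<Rightarrow> bool" where
  "stale S [] = False"
| "stale S (x # us) = (stale S us \<or> x \<notin> set us \<and> S x \<subseteq> \<Union>(S ` set us))"

text \<open>Consecutive cells share at least \<open>d\<close> vertices whenever a walk has nonzero
  weight. The closing step is left unrestricted, so this set contains all stale closed walks of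
  nonzero weight and possibly more.\<close>

definition stale_walks :: "'c set \<Rightarrow> ('c \<Rightarrow> 'v set) \<Rightarrow> nat \<Rightarrow> nat \<Rightarrow> 'c list set" where
  "stale_walks T S d k = {ts. set ts \<subseteq> T \<and> length ts = k \<and>
     successively (\<lambda>x y. d \<le> card (S x \<inter> S y)) ts \<and> stale S ts}"

text \<open>
  A column with a new vertex meets the earlier columns in the single facet omitting that vertex,
  so its signs can be normalised one column after the other.
\<close>

lemma exists_gauge:
  fixes s :: "'v set \<Rightarrow> 'c \<Rightarrow> real"
  assumes "\<not> stale S us" "\<And>x. x \<in> set us \<Longrightarrow> finite (S x) \<and> card (S x) = Suc d"
    and s: "\<And>r x. s r x \<in> {-1, 1}"
  shows "\<exists>\<eta> \<epsilon>. (\<forall>r. \<eta> r \<in> {-1, 1}) \<and> (\<forall>x. \<epsilon> x \<in> {-1, 1}) \<and>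
    (\<forall>x\<in>set us. \<forall>r. r \<subseteq> S x \<and> card r = d \<longrightarrow> s r x = \<eta> r * \<epsilon> x)"
  using assms(1,2)
proof (induction us)
  case Nil
  then show ?case by (intro exI[of _ "\<lambda>_. 1"]) auto
next
  case (Cons x us)
  then have "\<not> stale S us" "\<And>x. x \<in> set us \<Longrightarrow> finite (S x) \<and> card (S x) = Suc d"
    by auto
  from Cons.IH[OF this] obtain \<eta> \<epsilon> where \<eta>: "\<And>r. \<eta> r \<in> {-1, 1}" and \<epsilon>: "\<And>x. \<epsilon> x \<in> {-1, 1}"
    and old: "\<And>y r. y \<in> set us \<Longrightarrow> r \<subseteq> S y \<Longrightarrow> card r = d \<Longrightarrow> s r y = \<eta> r * \<epsilon> y"
    by metis
  show ?case
  proof (cases "x \<in> set us")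
    case True
    then show ?thesis using \<eta> \<epsilon> old by (intro exI[of _ \<eta>] exI[of _ \<epsilon>]) (auto simp: insert_absorb)
  next
    case False
    with Cons.prems obtain v where v: "v \<in> S x" "v \<notin> \<Union>(S ` set us)" by auto
    \<comment> \<open>The facet of \<open>S x\<close> opposite to \<open>v\<close> may already carry
      a fixed value of \<open>\<eta>\<close>, which dictates the sign \<open>e\<close> of the
      column. Every other facet contains \<open>v\<close>, hence lies in no earlier cell, and
      \<open>\<eta>\<close> may be redefined there.\<close>
    define e where "e = s (S x - {v}) x * \<eta> (S x - {v})"
    define \<epsilon>' where "\<epsilon>' = \<epsilon>(x := e)"
    define \<eta>' where "\<eta>' = (\<lambda>r. if v \<in> r then s r x * e else \<eta> r)"
    have e: "e \<in> {-1, 1}"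
      using s[of "S x - {v}" x] \<eta>[of "S x - {v}"] by (auto simp: e_def)
    have "s r y = \<eta>' r * \<epsilon>' y" if y: "y \<in> set (x # us)" and r: "r \<subseteq> S y" "card r = d" for y r
    proof (cases "y = x")
      case False
      then have "y \<in> set us" "v \<notin> r" using y r v by auto
      then show ?thesis using old r False by (auto simp: \<eta>'_def \<epsilon>'_def)
    next
      case True
      show ?thesis
      proof (cases "v \<in> r")
        case v_r: True
        then show ?thesis using True e by (auto simp: \<eta>'_def \<epsilon>'_def)
      next
        case v_r: False
        have "card (S x - {v}) = d" using Cons.prems(2)[of x] v by simp
        then have "r = S x - {v}"
          using r v_r True Cons.prems(2)[of x] by (intro card_subset_eq) auto
        then show ?thesis
          using True v_r \<eta>[of r] by (auto simp: \<eta>'_def \<epsilon>'_def e_def)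
      qed
    qed
    moreover have "\<eta>' r \<in> {-1, 1}" "\<epsilon>' y \<in> {-1, 1}" for r y
      using s[of r x] e \<eta>[of r] \<epsilon>[of y] by (auto simp: \<eta>'_def \<epsilon>'_def)
    ultimately show ?thesis by blast
  qed
qed

section \<open>The trace before and after a change of signs\<close>

text \<open>The comparison is made walk by walk. On a walk that is not stale the signs form a gauge
  and drop out. A stale walk outside \<open>stale_walks\<close> has weight 0 for both matrices. The
  others have weights in [-1, 1] by \<open>bound\<close>, so each costs at most 2.\<close>

lemma trace_le_trace_signed:
  fixes a :: "'v set \<Rightarrow> 'v set \<Rightarrow> real"
  assumes T: "finite T" "\<And>r. r \<in> T \<Longrightarrow> card r = d"
    and S: "\<And>x. x \<in> T \<Longrightarrow> finite (S x) \<and> card (S x) = Suc d"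
    and supp: "\<And>r x. r \<in> T \<Longrightarrow> x \<in> T \<Longrightarrow> a r x \<noteq> 0 \<Longrightarrow> r \<subseteq> S x"
    and g: "\<And>r. r \<in> T \<Longrightarrow> g r \<ge> 0"
    and bound: "\<And>x y. x \<in> T \<Longrightarrow> y \<in> T \<Longrightarrow> (\<Sum>r\<in>T. g r * \<bar>a r x\<bar> * \<bar>a r y\<bar>) \<le> 1"
    and s: "\<And>r x. s r x \<in> {-1, 1}"
  shows "(\<Sum>x\<in>T. kpow T (cogram T a g) (Suc k) x x)
    \<le> (\<Sum>x\<in>T. kpow T (cogram T (\<lambda>r x. s r x * a r x) g) (Suc k) x x)
      + 2 * real (card (stale_walks T S d (Suc k)))"
proof -
  let ?L = "{ts. set ts \<subseteq> T \<and> length ts = Suc k}"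
  let ?W = "stale_walks T S d (Suc k)"
  define a' where "a' = (\<lambda>r x. s r x * a r x)"
  let ?X = "cogram T a g" and ?Y = "cogram T a' g"
  have L: "finite ?L" by (rule finite_lists_length_eq[OF T(1)])
  have s2: "\<bar>s r x\<bar> = 1" for r x using s[of r x] by auto
  \<comment> \<open>Here and below \<open>b\<close> stands for \<open>a\<close> and
    \<open>a'\<close> alike, which have the same absolute values.\<close>
  have abs_le: "\<bar>cogram T b g x y\<bar> \<le> 1"
    if b: "\<And>r x. \<bar>b r x\<bar> = \<bar>a r x\<bar>" and xy: "x \<in> T" "y \<in> T" for b x y
  proof -
    have "\<bar>\<Sum>r\<in>T. g r * b r x * b r y\<bar> \<le> (\<Sum>r\<in>T. \<bar>g r * b r x * b r y\<bar>)" by (rule sum_abs)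
    also have "\<dots> = (\<Sum>r\<in>T. g r * \<bar>a r x\<bar> * \<bar>a r y\<bar>)"
      using g by (intro sum.cong) (auto simp: abs_mult b)
    finally have le: "\<bar>\<Sum>r\<in>T. g r * b r x * b r y\<bar> \<le> 1" using bound[OF xy] by simp
    \<comment> \<open>A diagonal entry is 1 minus such a sum, so there the sum has to lie in [0, 1]
      and not merely in [-1, 1].\<close>
    have "(\<Sum>r\<in>T. g r * b r x * b r x) \<ge> 0"
      using g by (intro sum_nonneg) (auto simp: mult.assoc)
    with le show ?thesis by (auto simp: cogram_def)
  qed
  have adj: "d \<le> card (S x \<inter> S y)" if "cogram T b g x y \<noteq> 0"
    and b: "\<And>r x. \<bar>b r x\<bar> = \<bar>a r x\<bar>" and xy: "x \<in> T" "y \<in> T" for b x y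
  proof (cases "x = y")
    case True
    then show ?thesis using S[OF xy(1)] by simp
  next
    case False
    then have "(\<Sum>r\<in>T. g r * b r x * b r y) \<noteq> 0" using that by (auto simp: cogram_def)
    then obtain r where "r \<in> T" "g r * b r x * b r y \<noteq> 0"
      using sum.not_neutral_contains_not_neutral by blast
    then have r: "r \<in> T" "b r x \<noteq> 0" "b r y \<noteq> 0" by auto
    have "a r x \<noteq> 0" "a r y \<noteq> 0" using r b[of r x] b[of r y] by auto
    then have "r \<subseteq> S x \<inter> S y" using supp r xy by blast
    then have "card r \<le> card (S x \<inter> S y)" using S[OF xy(1)] by (intro card_mono) auto
    then show ?thesis using T r by simp
  qed
  have a': "\<bar>a' r x\<bar> = \<bar>a r x\<bar>" for r x by (simp add: a'_def abs_mult s2)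
  have hd: "set (ts @ [hd ts]) = set ts" "set (ts @ [hd ts]) \<subseteq> T" if "ts \<in> ?L" for ts
    using that by (cases ts; auto)+
  have ineq: "path_weight ?X (ts @ [hd ts]) \<le> path_weight ?Y (ts @ [hd ts])
      + (if ts \<in> ?W then 2 else 0)" if ts: "ts \<in> ?L" for ts
  proof (cases "stale S ts")
    case False
    then obtain \<eta> \<epsilon> where \<eta>: "\<And>r. \<eta> r \<in> {-1, 1}" and \<epsilon>: "\<And>x. \<epsilon> x \<in> {-1, 1}"
      and se: "\<And>x r. x \<in> set ts \<Longrightarrow> r \<subseteq> S x \<Longrightarrow> card r = d \<Longrightarrow> s r x = \<eta> r * \<epsilon> x"
      using exists_gauge[of S ts d s] S s ts by blast
    have \<eta>2: "\<eta> r * \<eta> r = 1" for r using \<eta>[of r] by auto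
    have "?Y x y = \<epsilon> x * \<epsilon> y * ?X x y" if "x \<in> set ts" "y \<in> set ts" for x y
    proof -
      have xy: "x \<in> T" "y \<in> T" using that ts by auto
      have "g r * a' r x * a' r y = \<epsilon> x * \<epsilon> y * (g r * a r x * a r y)" if r: "r \<in> T" for r
      proof (cases "a r x = 0 \<or> a r y = 0")
        case False
        then have "r \<subseteq> S x" "r \<subseteq> S y" using supp r xy by auto
        then have "s r x * s r y = (\<eta> r * \<eta> r) * (\<epsilon> x * \<epsilon> y)"
          using se[OF \<open>x \<in> set ts\<close>, of r] se[OF \<open>y \<in> set ts\<close>, of r] T(2)[OF r]
          by (simp add: mult_ac)
        then have "s r x * s r y = \<epsilon> x * \<epsilon> y" by (simp add: \<eta>2)
        moreover have "g r * a' r x * a' r y = (s r x * s r y) * (g r * a r x * a r y)"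
          by (simp add: a'_def mult_ac)
        ultimately show ?thesis by simp
      qed (auto simp: a'_def)
      then have "(\<Sum>r\<in>T. g r * a' r x * a' r y) = \<epsilon> x * \<epsilon> y * (\<Sum>r\<in>T. g r * a r x * a r y)"
        unfolding sum_distrib_left by (rule sum.cong[OF refl])
      moreover have "\<epsilon> x * \<epsilon> x = 1" using \<epsilon>[of x] by auto
      ultimately show ?thesis by (auto simp: cogram_def algebra_simps)
    qed
    then have "path_weight ?Y (ts @ [hd ts])
        = \<epsilon> (hd (ts @ [hd ts])) * \<epsilon> (last (ts @ [hd ts])) * path_weight ?X (ts @ [hd ts])"
      using \<epsilon> hd(1)[OF ts] by (intro path_weight_gauge) auto
    also have "hd (ts @ [hd ts]) = hd ts" using ts by (cases ts) auto
    also have "\<epsilon> (hd ts) * \<epsilon> (last (ts @ [hd ts])) = 1" using \<epsilon>[of "hd ts"] by auto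
    finally show ?thesis by simp
  next
    case True
    show ?thesis
    proof (cases "ts \<in> ?W")
      case True
      have "\<bar>path_weight ?X (ts @ [hd ts])\<bar> \<le> 1" "\<bar>path_weight ?Y (ts @ [hd ts])\<bar> \<le> 1"
        using hd(2)[OF ts] abs_le[of a] abs_le[of a'] a'
        by (intro abs_path_weight_le_1; blast)+
      then show ?thesis using True by auto
    next
      case False
      have "path_weight (cogram T b g) (ts @ [hd ts]) = 0" if b: "\<And>r x. \<bar>b r x\<bar> = \<bar>a r x\<bar>" for b
      proof (rule ccontr)
        assume "path_weight (cogram T b g) (ts @ [hd ts]) \<noteq> 0"
        then have "successively (\<lambda>x y. d \<le> card (S x \<inter> S y)) (ts @ [hd ts])"
          by (rule successively_if_path_weight_nonzero) (use adj[OF _ b] hd(2)[OF ts] in blast)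
        then have "ts \<in> ?W"
          using ts \<open>stale S ts\<close> by (auto simp: stale_walks_def successively_append_iff)
        with False show False ..
      qed
      from this[of a] this[of a'] a' show ?thesis by simp
    qed
  qed
  have "(\<Sum>ts\<in>?L. path_weight ?X (ts @ [hd ts]))
      \<le> (\<Sum>ts\<in>?L. path_weight ?Y (ts @ [hd ts]) + (if ts \<in> ?W then 2 else 0))"
    by (rule sum_mono) (rule ineq)
  also have "\<dots> = (\<Sum>ts\<in>?L. path_weight ?Y (ts @ [hd ts])) + (\<Sum>ts\<in>?L \<inter> ?W. 2)"
    using L by (simp add: sum.distrib sum.If_cases)
  also have "?L \<inter> ?W = ?W" by (auto simp: stale_walks_def)
  finally show ?thesis
    unfolding trace_eq_sum_path_weight[OF T(1)] a'_def by (simp add: mult.commute)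
qed

text \<open>These weights make the matrix of absolute values a contraction, by Cauchy-Schwarz in
  each row and because each column has \<open>d + 1\<close> nonzero entries. In the sum of
  \<open>- ln (g r)\<close> each row contributes \<open>ln (d + 1)\<close> and the logarithm of its
  degree; the degrees average to \<open>d + 1\<close>, so by concavity their logarithms contribute
  at most another \<open>card T * ln (d + 1)\<close>.\<close>

lemma trace_le_ln_over_harm:
  fixes a :: "'v set \<Rightarrow> 'v set \<Rightarrow> real" and T :: "'v set set"
  defines "deg \<equiv> (\<lambda>S r. card {x \<in> T. r \<subseteq> S x})"
  assumes T: "finite T" "\<And>r. r \<in> T \<Longrightarrow> card r = d"
    and S: "\<And>x. x \<in> T \<Longrightarrow> finite (S x) \<and> card (S x) = Suc d \<and> x \<subseteq> S x"
    and facets: "\<And>x r. x \<in> T \<Longrightarrow> r \<subseteq> S x \<Longrightarrow> card r = d \<Longrightarrow> r \<in> T"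
    and a: "\<And>r x. r \<in> T \<Longrightarrow> x \<in> T \<Longrightarrow> \<bar>a r x\<bar> = (if r \<subseteq> S x then 1 else 0)"
    and g: "\<And>r. r \<in> T \<Longrightarrow> g r = 1 / (real (Suc d) * real (deg S r))"
  shows "(\<Sum>x\<in>T. kpow T (cogram T a g) (Suc k) x x)
    \<le> 2 * real (card T) * ln (real (Suc d)) / harm (Suc k)
      + 2 * real (card (stale_walks T S d (Suc k)))"
proof -
  \<comment> \<open>Each row is covered by the cell of its own column, so no weight divides by
    0.\<close>
  have deg: "deg S r \<ge> 1" if "r \<in> T" for r
  proof -
    have "{r} \<subseteq> {x \<in> T. r \<subseteq> S x}" using S that by auto
    then have "card {r} \<le> deg S r" unfolding deg_def using T by (intro card_mono) auto
    then show ?thesis by simp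
  qed
  have g0: "g r > 0" if "r \<in> T" for r using g[OF that] deg[OF that] by simp
  have num: "card {r \<in> T. r \<subseteq> S x} = Suc d" if "x \<in> T" for x
  proof -
    have "{r \<in> T. r \<subseteq> S x} = {r. r \<subseteq> S x \<and> card r = d}" using T facets that by auto
    then show ?thesis using S[OF that] n_subsets[of "S x" d] by simp
  qed
  \<comment> \<open>Double counting of incidences: there are as many rows as columns, and each
    column meets \<open>d + 1\<close> rows.\<close>
  have deg_sum: "(\<Sum>r\<in>T. real (deg S r)) = real (Suc d) * real (card T)"
  proof -
    have "(\<Sum>r\<in>T. real (deg S r)) = (\<Sum>r\<in>T. \<Sum>x\<in>T. if r \<subseteq> S x then 1 else 0)"
      unfolding deg_def using T by (simp add: sum.If_cases Int_def)
    also have "\<dots> = (\<Sum>x\<in>T. \<Sum>r\<in>T. if r \<subseteq> S x then 1 else 0)" by (rule sum.swap)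
    also have "\<dots> = (\<Sum>x\<in>T. real (card {r \<in> T. r \<subseteq> S x}))"
      using T by (simp add: sum.If_cases Int_def)
    finally show ?thesis using num by simp
  qed
  have contr: "(\<Sum>r\<in>T. g r * (\<Sum>x\<in>T. \<bar>a r x\<bar> * u x)\<^sup>2) \<le> (\<Sum>x\<in>T. (u x)\<^sup>2)" for u
  proof -
    have "g r * (\<Sum>x\<in>T. \<bar>a r x\<bar> * u x)\<^sup>2
        \<le> 1 / real (Suc d) * (\<Sum>x\<in>T. if r \<subseteq> S x then (u x)\<^sup>2 else 0)" if r: "r \<in> T" for r
    proof -
      let ?C = "{x \<in> T. r \<subseteq> S x}"
      have "(\<Sum>x\<in>T. \<bar>a r x\<bar> * u x) = (\<Sum>x\<in>T. if r \<subseteq> S x then u x else 0)"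
        using a r by (intro sum.cong) auto
      also have "\<dots> = (\<Sum>x\<in>?C. u x * 1)" using T by (simp add: sum.If_cases Int_def)
      also have "(\<dots>)\<^sup>2 \<le> (\<Sum>x\<in>?C. (u x)\<^sup>2) * (\<Sum>x\<in>?C. 1\<^sup>2)"
        by (rule Cauchy_Schwarz_ineq_sum)
      also have "\<dots> = (\<Sum>x\<in>T. if r \<subseteq> S x then (u x)\<^sup>2 else 0) * real (deg S r)"
        using T by (simp add: deg_def sum.If_cases Int_def)
      finally have "g r * (\<Sum>x\<in>T. \<bar>a r x\<bar> * u x)\<^sup>2
          \<le> g r * ((\<Sum>x\<in>T. if r \<subseteq> S x then (u x)\<^sup>2 else 0) * real (deg S r))"
        using g0[OF r] by (intro mult_left_mono) auto
      also have "\<dots> = 1 / real (Suc d) * (\<Sum>x\<in>T. if r \<subseteq> S x then (u x)\<^sup>2 else 0)"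
        using deg[OF r] by (simp add: g[OF r] del: of_nat_Suc)
      finally show ?thesis .
    qed
    then have "(\<Sum>r\<in>T. g r * (\<Sum>x\<in>T. \<bar>a r x\<bar> * u x)\<^sup>2)
        \<le> (\<Sum>r\<in>T. 1 / real (Suc d) * (\<Sum>x\<in>T. if r \<subseteq> S x then (u x)\<^sup>2 else 0))"
      by (rule sum_mono)
    also have "\<dots> = 1 / real (Suc d) * (\<Sum>x\<in>T. \<Sum>r\<in>T. if r \<subseteq> S x then (u x)\<^sup>2 else 0)"
      unfolding sum_distrib_left[symmetric] by (subst sum.swap) simp
    also have "\<dots> = 1 / real (Suc d) * (\<Sum>x\<in>T. real (card {r \<in> T. r \<subseteq> S x}) * (u x)\<^sup>2)"
      using T by (simp add: sum.If_cases Int_def)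
    also have "\<dots> = (\<Sum>x\<in>T. (u x)\<^sup>2)"
      using num by (simp add: sum_distrib_left[symmetric])
    finally show ?thesis .
  qed
  have bound: "(\<Sum>r\<in>T. g r * \<bar>a r x\<bar> * \<bar>a r y\<bar>) \<le> 1" if "x \<in> T" "y \<in> T" for x y
  proof -
    have "(\<Sum>r\<in>T. g r * \<bar>a r x\<bar> * \<bar>a r y\<bar>) \<le> (\<Sum>r\<in>T. if r \<subseteq> S x then 1 / real (Suc d) else 0)"
    proof (rule sum_mono)
      fix r assume r: "r \<in> T"
      have "g r \<le> 1 / real (Suc d)"
        unfolding g[OF r] using deg[OF r] by (intro divide_left_mono) auto
      then show "g r * \<bar>a r x\<bar> * \<bar>a r y\<bar> \<le> (if r \<subseteq> S x then 1 / real (Suc d) else 0)"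
        using a[OF r] that by auto
    qed
    also have "\<dots> = 1" using T num[OF that(1)] by (simp add: sum.If_cases Int_def)
    finally show ?thesis .
  qed
  obtain s where s: "\<And>r x. s r x \<in> {-1, 1::real}"
    and tr: "(\<Sum>x\<in>T. kpow T (cogram T (\<lambda>r x. s r x * a r x) g) (Suc k) x x) * harm (Suc k)
      \<le> (\<Sum>r\<in>T. - ln (g r))"
    using exists_signs_trace_le[of T a g "Suc k"] T a S g0 contr by auto
  \<comment> \<open>The logarithm of the degree is replaced by its tangent at \<open>d + 1\<close>;
    the linear corrections \<open>deg / (d + 1) - 1\<close> sum to 0 by
    \<open>deg_sum\<close>.\<close>
  have "(\<Sum>r\<in>T. - ln (g r)) \<le> (\<Sum>r\<in>T. 2 * ln (real (Suc d)) + (real (deg S r) / real (Suc d) - 1))"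
  proof (rule sum_mono)
    fix r assume r: "r \<in> T"
    have "- ln (g r) = ln (real (Suc d)) + ln (real (deg S r))"
      using deg[OF r] by (simp add: g[OF r] ln_div ln_mult_pos)
    moreover have "ln (real (deg S r) / real (Suc d)) \<le> real (deg S r) / real (Suc d) - 1"
      using deg[OF r] by (intro ln_le_minus_one) auto
    moreover have "ln (real (deg S r) / real (Suc d)) = ln (real (deg S r)) - ln (real (Suc d))"
      using deg[OF r] by (intro ln_divide_pos) auto
    ultimately show "- ln (g r) \<le> 2 * ln (real (Suc d)) + (real (deg S r) / real (Suc d) - 1)"
      by linarith
  qed
  also have "\<dots> = 2 * real (card T) * ln (real (Suc d))"
    by (simp add: sum.distrib sum_subtractf sum_divide_distrib[symmetric] deg_sum)
  finally have "(\<Sum>x\<in>T. kpow T (cogram T (\<lambda>r x. s r x * a r x) g) (Suc k) x x)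
      \<le> 2 * real (card T) * ln (real (Suc d)) / harm (Suc k)"
    using tr by (simp add: pos_le_divide_eq harm_pos)
  moreover have "(\<Sum>x\<in>T. kpow T (cogram T a g) (Suc k) x x)
    \<le> (\<Sum>x\<in>T. kpow T (cogram T (\<lambda>r x. s r x * a r x) g) (Suc k) x x)
      + 2 * real (card (stale_walks T S d (Suc k)))"
  proof (rule trace_le_trace_signed)
    show "r \<subseteq> S x" if "r \<in> T" "x \<in> T" "a r x \<noteq> 0" for r x
      using a[OF that(1,2)] that(3) by (auto split: if_splits)
  qed (use T S g0 bound s in \<open>auto simp: less_imp_le\<close>)
  ultimately show ?thesis by linarith
qed

section \<open>Homology in the top dimension\<close>

text \<open>\<open>q x\<close> is the diagonal entry at \<open>x\<close> of the orthogonal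
  projection onto the span of the \<open>z i\<close>, and \<open>w\<close> is column
  \<open>x\<close> of that projection. As \<open>P\<close> fixes the span, row \<open>x\<close> of
  \<open>P\<close> times \<open>w\<close> is \<open>q x\<close>, while \<open>w\<close> has squared
  norm \<open>q x\<close>; Cauchy-Schwarz bounds \<open>q x\<close> by the squared norm of the row.
  The trace of the projection is \<open>card I\<close>.\<close>

lemma card_orthogonal_le_frobenius:
  fixes P :: "'a \<Rightarrow> 'a \<Rightarrow> real" and z :: "'i \<Rightarrow> 'a \<Rightarrow> real"
  assumes T: "finite T" and I: "finite I"
    and orth: "\<And>i j. i \<in> I \<Longrightarrow> j \<in> I \<Longrightarrow> i \<noteq> j \<Longrightarrow> (\<Sum>x\<in>T. z i x * z j x) = 0"
    and nz: "\<And>i. i \<in> I \<Longrightarrow> (\<Sum>x\<in>T. z i x * z i x) > 0"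
    and fixed: "\<And>i x. i \<in> I \<Longrightarrow> x \<in> T \<Longrightarrow> (\<Sum>y\<in>T. P x y * z i y) = z i x"
  shows "real (card I) \<le> (\<Sum>x\<in>T. \<Sum>y\<in>T. (P x y)\<^sup>2)"
proof -
  define N where "N = (\<lambda>i. \<Sum>x\<in>T. z i x * z i x)"
  define q where "q = (\<lambda>x. \<Sum>i\<in>I. z i x * z i x / N i)"
  have "q x \<le> (\<Sum>y\<in>T. (P x y)\<^sup>2)" if x: "x \<in> T" for x
  proof -
    define w where "w = (\<lambda>y. \<Sum>i\<in>I. z i x / N i * z i y)"
    have wx: "w x = q x" by (simp add: w_def q_def)
    have "(\<Sum>y\<in>T. P x y * w y) = (\<Sum>y\<in>T. \<Sum>i\<in>I. z i x / N i * (P x y * z i y))"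
      unfolding w_def sum_distrib_left by (simp add: mult_ac)
    also have "\<dots> = (\<Sum>i\<in>I. z i x / N i * (\<Sum>y\<in>T. P x y * z i y))"
      unfolding sum_distrib_left by (rule sum.swap)
    also have "\<dots> = w x" using fixed x by (simp add: w_def)
    finally have Pw: "(\<Sum>y\<in>T. P x y * w y) = q x" using wx by simp
    have "(\<Sum>y\<in>T. w y * w y) = (\<Sum>y\<in>T. \<Sum>i\<in>I. \<Sum>j\<in>I. (z i x / N i * (z j x / N j)) * (z i y * z j y))"
      unfolding w_def sum_product by (simp add: mult_ac)
    also have "\<dots> = (\<Sum>i\<in>I. \<Sum>y\<in>T. \<Sum>j\<in>I. (z i x / N i * (z j x / N j)) * (z i y * z j y))"
      by (rule sum.swap)
    also have "\<dots> = (\<Sum>i\<in>I. \<Sum>j\<in>I. (z i x / N i * (z j x / N j)) * (\<Sum>y\<in>T. z i y * z j y))"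
      unfolding sum_distrib_left by (intro sum.cong refl sum.swap)
    also have "\<dots> = (\<Sum>i\<in>I. \<Sum>j\<in>I. if j = i then z i x * z i x / N i else 0)"
    proof (intro sum.cong refl)
      fix i j assume ij: "i \<in> I" "j \<in> I"
      then have "N i \<noteq> 0" "(\<Sum>y\<in>T. z i y * z i y) = N i"
        using nz[of i] by (auto simp: N_def)
      with ij show "(z i x / N i * (z j x / N j)) * (\<Sum>y\<in>T. z i y * z j y)
          = (if j = i then z i x * z i x / N i else 0)"
        using orth[of i j] by auto
    qed
    also have "\<dots> = q x" using I by (simp add: q_def)
    finally have ww: "(\<Sum>y\<in>T. (w y)\<^sup>2) = q x" by (simp add: power2_eq_square)
    have "(q x)\<^sup>2 \<le> (\<Sum>y\<in>T. (P x y)\<^sup>2) * q x"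
      using Cauchy_Schwarz_ineq_sum[of "P x" w T] unfolding Pw ww .
    moreover have "q x \<ge> 0" unfolding ww[symmetric] by (intro sum_nonneg) auto
    moreover have "(\<Sum>y\<in>T. (P x y)\<^sup>2) \<ge> 0" by (intro sum_nonneg) auto
    ultimately show ?thesis
      by (cases "q x = 0") (auto simp: power2_eq_square)
  qed
  then have "(\<Sum>x\<in>T. q x) \<le> (\<Sum>x\<in>T. \<Sum>y\<in>T. (P x y)\<^sup>2)" by (rule sum_mono)
  moreover have "(\<Sum>x\<in>T. q x) = (\<Sum>i\<in>I. N i / N i)"
    unfolding q_def by (subst sum.swap) (simp only: N_def sum_divide_distrib)
  moreover have "(\<Sum>i\<in>I. N i / N i) = (\<Sum>i\<in>I. 1)"
  proof (intro sum.cong refl)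
    show "N i / N i = 1" if "i \<in> I" for i using nz[OF that] by (simp add: N_def)
  qed
  ultimately show ?thesis by simp
qed

text \<open>Kernel vectors of \<open>a\<close> are fixed by the matrix \<open>cogram R a g\<close>,
  hence by its \<open>k\<close>-th power. By symmetry the squared Frobenius norm of this power is
  the trace of the power \<open>k + k\<close>, which is why even exponents appear.\<close>

lemma card_orthogonal_kernel_le_trace:
  fixes a :: "'r \<Rightarrow> 'a \<Rightarrow> real" and z :: "'i \<Rightarrow> 'a \<Rightarrow> real"
  assumes T: "finite T" and I: "finite I"
    and orth: "\<And>i j. i \<in> I \<Longrightarrow> j \<in> I \<Longrightarrow> i \<noteq> j \<Longrightarrow> (\<Sum>x\<in>T. z i x * z j x) = 0"
    and nz: "\<And>i. i \<in> I \<Longrightarrow> (\<Sum>x\<in>T. z i x * z i x) > 0"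
    and ker: "\<And>i r. i \<in> I \<Longrightarrow> r \<in> R \<Longrightarrow> (\<Sum>x\<in>T. a r x * z i x) = 0"
  shows "real (card I) \<le> (\<Sum>x\<in>T. kpow T (cogram R a g) (k + k) x x)"
proof -
  let ?X = "cogram R a g"
  have X1: "(\<Sum>y\<in>T. ?X x y * z i y) = z i x" if "i \<in> I" "x \<in> T" for i x
  proof -
    have "(\<Sum>y\<in>T. ?X x y * z i y)
        = (\<Sum>y\<in>T. if x = y then z i y else 0) - (\<Sum>y\<in>T. \<Sum>r\<in>R. g r * a r x * a r y * z i y)"
      by (simp add: cogram_def left_diff_distrib sum_subtractf sum_distrib_right
          if_distrib[of "\<lambda>b. b * _"] cong: if_cong)
    also have "(\<Sum>y\<in>T. \<Sum>r\<in>R. g r * a r x * a r y * z i y)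
        = (\<Sum>r\<in>R. g r * a r x * (\<Sum>y\<in>T. a r y * z i y))"
      unfolding sum_distrib_left by (subst sum.swap) (simp add: mult_ac)
    also have "\<dots> = 0" using ker[OF that(1)] by simp
    finally show ?thesis using that T by simp
  qed
  have Xk: "(\<Sum>y\<in>T. kpow T ?X k x y * z i y) = z i x" if "i \<in> I" "x \<in> T" for i x
    using that(2)
  proof (induction k arbitrary: x)
    case 0
    then show ?case using T by (simp add: if_distrib[of "\<lambda>b. b * _"] cong: if_cong)
  next
    case (Suc k)
    have "(\<Sum>y\<in>T. kpow T ?X (Suc k) x y * z i y)
        = (\<Sum>u\<in>T. ?X x u * (\<Sum>y\<in>T. kpow T ?X k u y * z i y))"
      unfolding kpow.simps sum_distrib_left sum_distrib_right
      by (subst sum.swap) (simp add: mult_ac)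
    also have "\<dots> = (\<Sum>u\<in>T. ?X x u * z i u)" using Suc.IH by simp
    finally show ?case using X1[OF that(1) Suc.prems] by simp
  qed
  have sym: "?X x y = ?X y x" for x y by (auto simp: cogram_def mult_ac)
  have "real (card I) \<le> (\<Sum>x\<in>T. \<Sum>y\<in>T. (kpow T ?X k x y)\<^sup>2)"
    using T I orth nz Xk by (rule card_orthogonal_le_frobenius)
  also have "\<dots> = (\<Sum>x\<in>T. kpow T ?X (k + k) x x)"
    using kpow_sym[where X = "cogram R a g", OF T sym]
    by (intro sum.cong refl) (simp add: kpow_add[OF T] power2_eq_square)
  finally show ?thesis .
qed

section \<open>Linearity of the boundary, and homology as the space of cycles\<close>

text \<open>A summation range common to several chains makes the boundary visibly linear.\<close>

lemma boundary_eq_sum: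
  assumes "finite F" "Poly_Mapping.keys c \<subseteq> F"
  shows "boundary k c = (if k = 0 then 0 else \<Sum>\<sigma>\<in>F. \<Sum>v\<in>\<sigma>.
    Poly_Mapping.single (\<sigma> - {v}) (Poly_Mapping.lookup c \<sigma> * (-1) ^ card {u \<in> \<sigma>. u < v}))"
proof -
  have "(\<Sum>\<sigma>\<in>Poly_Mapping.keys c. \<Sum>v\<in>\<sigma>.
      Poly_Mapping.single (\<sigma> - {v}) (Poly_Mapping.lookup c \<sigma> * (-1) ^ card {u \<in> \<sigma>. u < v}))
    = (\<Sum>\<sigma>\<in>F. \<Sum>v\<in>\<sigma>.
      Poly_Mapping.single (\<sigma> - {v}) (Poly_Mapping.lookup c \<sigma> * (-1) ^ card {u \<in> \<sigma>. u < v}))"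
    using assms by (intro sum.mono_neutral_left) (auto simp: in_keys_iff)
  then show ?thesis by (simp add: boundary_def)
qed

lemma lookup_map_times: "Poly_Mapping.lookup (Poly_Mapping.map ((*) r) c) x = r * Poly_Mapping.lookup c x"
  for r :: "'a::mult_zero"
  by (simp add: Poly_Mapping.map.rep_eq when_def)

lemma keys_lincomb_subset:
  fixes c c' :: "'b \<Rightarrow>\<^sub>0 rat"
  shows "Poly_Mapping.keys (Poly_Mapping.map ((*) r) c + c') \<subseteq> Poly_Mapping.keys c \<union> Poly_Mapping.keys c'"
  by (auto simp: in_keys_iff lookup_add lookup_map_times)

lemma boundary_lincomb:
  "boundary k (Poly_Mapping.map ((*) r) c + c')
    = Poly_Mapping.map ((*) r) (boundary k c) + boundary k c'"
proof (rule poly_mapping_eqI)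
  fix \<rho>
  let ?F = "Poly_Mapping.keys c \<union> Poly_Mapping.keys c'"
  show "Poly_Mapping.lookup (boundary k (Poly_Mapping.map ((*) r) c + c')) \<rho>
    = Poly_Mapping.lookup (Poly_Mapping.map ((*) r) (boundary k c) + boundary k c') \<rho>"
    using keys_lincomb_subset[of r c c']
    by (simp add: boundary_eq_sum[of ?F] lookup_add lookup_map_times lookup_sum lookup_single
        sum_distrib_left sum.distrib[symmetric] when_def algebra_simps if_distrib cong: if_cong)
qed


lemma zero_in_cycles: "0 \<in> cycles K k"
  by (simp add: cycles_def chains_def boundary_def)

lemma cycles_lincomb:
  assumes "c \<in> cycles K k" "c' \<in> cycles K k"
  shows "Poly_Mapping.map ((*) r) c + c' \<in> cycles K k"
proof -
  have "Poly_Mapping.map ((*) r) 0 = (0 :: 'a set \<Rightarrow>\<^sub>0 rat)"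
    by (rule poly_mapping_eqI) (simp add: lookup_map_times)
  then show ?thesis
    using assms keys_lincomb_subset[of r c c'] by (auto simp: cycles_def chains_def boundary_lincomb)
qed

lemma cycles_smult: "c \<in> cycles K k \<Longrightarrow> Poly_Mapping.map ((*) r) c \<in> cycles K k"
  using cycles_lincomb[OF _ zero_in_cycles] by fastforce

lemma map_times_one: "Poly_Mapping.map ((*) 1) c = c" for c :: "'b \<Rightarrow>\<^sub>0 rat"
  by (rule poly_mapping_eqI) (simp add: lookup_map_times)

lemma cycles_add: "c \<in> cycles K k \<Longrightarrow> c' \<in> cycles K k \<Longrightarrow> c + c' \<in> cycles K k"
  using cycles_lincomb[of c K k c' 1] by (simp add: map_times_one)

context
  fixes K :: "'v::linorder set set" and k :: nat
  assumes no_faces: "faces K (k + 1) = {}"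
begin

lemma boundaries_eq: "boundaries K k = {0}"
proof -
  have "chains K (k + 1) = {0}" using no_faces by (auto simp: chains_def)
  then show ?thesis by (simp add: boundaries_def boundary_def)
qed

text \<open>Cosets of the zero subspace are singletons, so homology is the space of cycles in
  disguise. The operations are computed below through the identification
  \<open>z \<mapsto> {z}\<close>.\<close>

lemma carrier_homology: "carrier (homology k K) = (\<lambda>z. {z}) ` cycles K k"
  by (auto simp: homology_def module_quotient_def boundaries_eq A_RCOSETS_defs a_r_coset_def
      r_coset_def chain_module_def image_def)

lemma zero_homology: "\<zero>\<^bsub>homology k K\<^esub> = {0}"
  by (simp add: homology_def module_quotient_def boundaries_eq)

lemma add_homology: "{x} \<oplus>\<^bsub>homology k K\<^esub> {y} = {x + y}"
  by (simp add: homology_def module_quotient_def set_add_def set_mult_def chain_module_def)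

lemma smult_homology: "r \<odot>\<^bsub>homology k K\<^esub> {x} = {Poly_Mapping.map ((*) r) x}"
  by (simp add: homology_def module_quotient_def boundaries_eq a_r_coset_def r_coset_def
      chain_module_def)

lemma vectorspace_homology: "vectorspace class_ring (homology k K)"
proof (rule vs_criteria[OF class_field])
  have neg: "x + Poly_Mapping.map ((*) (- 1)) x = 0" for x :: "'v set \<Rightarrow>\<^sub>0 rat"
    by (rule poly_mapping_eqI) (simp add: lookup_add lookup_map_times)
  show "\<forall>v\<in>carrier (homology k K). \<exists>neg_v\<in>carrier (homology k K).
      v \<oplus>\<^bsub>homology k K\<^esub> neg_v = \<zero>\<^bsub>homology k K\<^esub>"
    using neg by (fastforce simp: carrier_homology zero_homology add_homology intro: cycles_smult)
qed (auto simp: carrier_homology zero_homology add_homology smult_homology zero_in_cycles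
    lookup_add lookup_map_times algebra_simps intro!: cycles_add cycles_smult poly_mapping_eqI)

text \<open>A generating set bounds the dimension; \<open>lc\<close> matches plain sums of chains
  with the abstract linear combinations of the homology space.\<close>

lemma homology_dim_le_card:
  assumes A: "finite A" "A \<subseteq> cycles K k"
    and gen: "\<And>z. z \<in> cycles K k \<Longrightarrow> \<exists>q. z = (\<Sum>c\<in>A. Poly_Mapping.map ((*) (q c)) c)"
  shows "homology_dim k K \<le> card A"
proof -
  interpret V: vectorspace "class_ring :: rat ring" "homology k K"
    by (rule vectorspace_homology)
  let ?A = "(\<lambda>c. {c}) ` A"
  have lc: "V.lincomb q ((\<lambda>c. {c}) ` B) = {\<Sum>c\<in>B. Poly_Mapping.map ((*) (q {c})) c}"
    if "finite B" "B \<subseteq> cycles K k" for q B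
    using that
  proof (induction B)
    case empty
    then show ?case by (simp add: V.lincomb_def zero_homology)
  next
    case (insert c B)
    have "V.lincomb q (insert {c} ((\<lambda>c. {c}) ` B))
        = (q {c} \<odot>\<^bsub>homology k K\<^esub> {c}) \<oplus>\<^bsub>homology k K\<^esub> V.lincomb q ((\<lambda>c. {c}) ` B)"
      unfolding V.lincomb_def using insert
      by (intro V.finsum_insert)
        (auto simp: carrier_homology smult_homology intro!: imageI cycles_smult)
    then show ?case using insert by (simp add: smult_homology add_homology)
  qed
  have "V.span ?A = carrier (homology k K)"
  proof
    show "V.span ?A \<subseteq> carrier (homology k K)"
      using A by (intro V.span_is_subset2) (auto simp: carrier_homology)
    show "carrier (homology k K) \<subseteq> V.span ?A"
    proof
      fix v assume "v \<in> carrier (homology k K)"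
      then obtain z where z: "v = {z}" "z \<in> cycles K k" by (auto simp: carrier_homology)
      obtain q where q: "z = (\<Sum>c\<in>A. Poly_Mapping.map ((*) (q c)) c)" using gen[OF z(2)] by blast
      \<comment> \<open>Abstract coefficients are indexed by the singletons; \<open>the_elem\<close>
        recovers the cycle.\<close>
      have "v = V.lincomb (\<lambda>c. q (the_elem c)) ?A"
        using lc[OF A] q z by simp
      then show "v \<in> V.span ?A"
        unfolding V.span_def using A by auto
    qed
  qed
  then have "V.dim \<le> card ?A"
    using A by (intro V.gen_ge_dim) (auto simp: carrier_homology)
  then show ?thesis
    using card_image_le[OF A(1), of "\<lambda>c. {c}"] by (simp add: homology_dim_def)
qed

end


text \<open>
  A maximal orthogonal family of nonzero cycles spans: what remains of a cycle after subtracting its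
  projections is a cycle orthogonal to the family, hence zero.
\<close>

lemma homology_dim_le_orthogonal_bound:
  fixes K :: "'v::linorder set set" and B :: real
  assumes no_faces: "faces K (k + 1) = {}" and F: "finite (faces K k)"
    and bound: "\<And>A. finite A \<Longrightarrow> A \<subseteq> cycles K k - {0} \<Longrightarrow>
      (\<And>c c'. c \<in> A \<Longrightarrow> c' \<in> A \<Longrightarrow> c \<noteq> c' \<Longrightarrow>
        (\<Sum>\<sigma>\<in>faces K k. Poly_Mapping.lookup c \<sigma> * Poly_Mapping.lookup c' \<sigma>) = 0) \<Longrightarrow>
      real (card A) \<le> B"
  shows "real (homology_dim k K) \<le> B"
proof -
  define ip where "ip = (\<lambda>c c' :: 'v set \<Rightarrow>\<^sub>0 rat.
    \<Sum>\<sigma>\<in>faces K k. Poly_Mapping.lookup c \<sigma> * Poly_Mapping.lookup c' \<sigma>)"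
  define P where "P = (\<lambda>A. finite A \<and> A \<subseteq> cycles K k - {0} \<and>
    (\<forall>c\<in>A. \<forall>c'\<in>A. c \<noteq> c' \<longrightarrow> ip c c' = 0))"
  have PB: "real (card A) \<le> B" if "P A" for A
    using that bound[of A] by (auto simp: P_def ip_def)
  have "P {}" by (simp add: P_def)
  \<comment> \<open>\<open>B\<close> caps the size of every orthogonal family, so one of largest
    cardinality exists.\<close>
  moreover have "\<forall>A. P A \<longrightarrow> card A < nat \<lfloor>B\<rfloor> + 1"
    using PB by (auto simp: less_Suc_eq_le le_nat_floor)
  ultimately obtain A where A: "P A" and max: "\<And>A'. P A' \<Longrightarrow> card A' \<le> card A"
    using ex_has_greatest_nat[of P "{}" card] by blast
  have pos: "ip c c > 0" if c: "c \<in> cycles K k" "c \<noteq> 0" for c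
  proof -
    obtain \<sigma> where \<sigma>: "Poly_Mapping.lookup c \<sigma> \<noteq> 0" using c(2)
      by (metis lookup_zero poly_mapping_eqI)
    then have "\<sigma> \<in> faces K k" using c(1) by (auto simp: cycles_def chains_def in_keys_iff)
    then show ?thesis unfolding ip_def
      using F \<sigma> by (intro sum_pos2[of _ \<sigma>]) (auto simp: zero_less_mult_iff)
  qed
  have "homology_dim k K \<le> card A"
  proof (rule homology_dim_le_card[OF no_faces])
    show "finite A" "A \<subseteq> cycles K k" using A by (auto simp: P_def)
    fix z assume z: "z \<in> cycles K k"
    define q where "q = (\<lambda>c. ip z c / ip c c)"
    define p where "p = (\<Sum>c\<in>A. Poly_Mapping.map ((*) (q c)) c)"
    define w where "w = Poly_Mapping.map ((*) (- 1)) p + z"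
    have p: "p \<in> cycles K k"
    proof -
      have "(\<Sum>c\<in>A'. Poly_Mapping.map ((*) (q c)) c) \<in> cycles K k" if "finite A'" "A' \<subseteq> A" for A'
        using that
      proof (induction A')
        case (insert c A')
        then show ?case
          using A by (auto simp: P_def intro!: cycles_lincomb)
      qed (simp add: zero_in_cycles)
      then show ?thesis using A by (simp add: p_def P_def)
    qed
    have w: "w \<in> cycles K k" unfolding w_def using p z by (rule cycles_lincomb)
    have wc: "ip w c = 0" if c: "c \<in> A" for c
    proof -
      have c_pos: "ip c c > 0" using A c by (intro pos) (auto simp: P_def)
      have "ip p c = (\<Sum>b\<in>A. q b * ip b c)"
        unfolding ip_def p_def lookup_sum lookup_map_times sum_distrib_right sum_distrib_left
        by (subst sum.swap) (simp add: mult_ac)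
      also have "\<dots> = (\<Sum>b\<in>A. if b = c then q c * ip c c else 0)"
        using A c by (intro sum.cong) (auto simp: P_def)
      also have "\<dots> = ip z c"
        using A c c_pos by (simp add: P_def q_def)
      finally have "ip p c = ip z c" .
      moreover have "ip w c = ip z c - ip p c"
        by (simp add: ip_def w_def lookup_add lookup_map_times algebra_simps sum_subtractf)
      ultimately show ?thesis by simp
    qed
    have "w = 0"
    proof (rule ccontr)
      assume "w \<noteq> 0"
      then have "w \<notin> A" using wc[of w] pos[of w] w by auto
      have "ip c w = 0" if "c \<in> A" for c
        using wc[OF that] by (simp add: ip_def mult.commute)
      then have "P (insert w A)"
        using A w \<open>w \<noteq> 0\<close> wc by (auto simp: P_def)
      then have "card (insert w A) \<le> card A" by (rule max)
      then show False using \<open>w \<notin> A\<close> A by (simp add: P_def)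
    qed
    have "z = p"
    proof (rule poly_mapping_eqI)
      fix \<sigma>
      have "Poly_Mapping.lookup w \<sigma> = 0" using \<open>w = 0\<close> by simp
      then show "Poly_Mapping.lookup z \<sigma> = Poly_Mapping.lookup p \<sigma>"
        by (simp add: w_def lookup_add lookup_map_times)
    qed
    then show "\<exists>q. z = (\<Sum>c\<in>A. Poly_Mapping.map ((*) (q c)) c)" unfolding p_def by blast
  qed
  then show ?thesis using PB[OF A] by linarith
qed

text \<open>If \<open>\<rho> \<subseteq> \<sigma>\<close>, exactly one vertex of
  \<open>\<sigma>\<close> leaves \<open>\<rho>\<close> when omitted, namely the element of
  \<open>\<sigma> - \<rho>\<close>. So each coefficient of the boundary is a row of the signed
  incidence matrix applied to the chain.\<close>

lemma lookup_boundary_facet: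
  assumes F: "finite F" "Poly_Mapping.keys c \<subseteq> F" "\<And>\<sigma>. \<sigma> \<in> F \<Longrightarrow> finite \<sigma> \<and> card \<sigma> = Suc (card \<rho>)"
    and k: "k \<noteq> 0" and \<rho>: "finite \<rho>"
  shows "Poly_Mapping.lookup (boundary k c) \<rho> = (\<Sum>\<sigma>\<in>F. Poly_Mapping.lookup c \<sigma> *
    (if \<rho> \<subseteq> \<sigma> then (-1) ^ card {u \<in> \<sigma>. u < the_elem (\<sigma> - \<rho>)} else 0))"
proof -
  have "(\<Sum>v\<in>\<sigma>. Poly_Mapping.lookup (Poly_Mapping.single (\<sigma> - {v})
          (Poly_Mapping.lookup c \<sigma> * (-1) ^ card {u \<in> \<sigma>. u < v})) \<rho>)
      = Poly_Mapping.lookup c \<sigma> *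
        (if \<rho> \<subseteq> \<sigma> then (-1) ^ card {u \<in> \<sigma>. u < the_elem (\<sigma> - \<rho>)} else 0)"
    if \<sigma>: "\<sigma> \<in> F" for \<sigma>
  proof (cases "\<rho> \<subseteq> \<sigma>")
    case False
    then show ?thesis by (auto simp: lookup_single when_def intro!: sum.neutral)
  next
    case True
    have "card (\<sigma> - \<rho>) = 1" using F(3)[OF \<sigma>] True \<rho> by (simp add: card_Diff_subset)
    then obtain x where x: "\<sigma> - \<rho> = {x}" by (auto simp: card_1_singleton_iff)
    then have eq: "\<sigma> - {v} = \<rho> \<longleftrightarrow> v = x" if "v \<in> \<sigma>" for v using True that by blast
    have "x \<in> \<sigma>" using x by blast
    have "(\<Sum>v\<in>\<sigma>. Poly_Mapping.lookup (Poly_Mapping.single (\<sigma> - {v})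
          (Poly_Mapping.lookup c \<sigma> * (-1) ^ card {u \<in> \<sigma>. u < v})) \<rho>)
      = (\<Sum>v\<in>\<sigma>. if v = x then Poly_Mapping.lookup c \<sigma> * (-1) ^ card {u \<in> \<sigma>. u < x} else 0)"
      using eq by (intro sum.cong) (auto simp: lookup_single when_def)
    also have "\<dots> = Poly_Mapping.lookup c \<sigma> * (-1) ^ card {u \<in> \<sigma>. u < x}"
      using F(3)[OF \<sigma>] \<open>x \<in> \<sigma>\<close> by simp
    finally show ?thesis using True x by simp
  qed
  then show ?thesis using F k by (simp add: boundary_eq_sum[of F] lookup_sum)
qed

section \<open>Cycles of a 1-out complex as kernel vectors\<close>

text \<open>Columns are indexed by \<open>(d-1)\<close>-faces, so a \<open>d\<close>-face chosen
  several times gives several equal columns. Putting each coefficient of a cycle on just one of them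
  turns orthogonal cycles into orthogonal kernel vectors, whose number the trace bounds.\<close>

lemma homology_dim_one_out_le:
  fixes d n k :: nat and v :: "nat set \<Rightarrow> nat"
  defines "T \<equiv> {\<tau>. \<tau> \<subseteq> {1..n} \<and> card \<tau> = d}" and "S \<equiv> (\<lambda>\<tau>. insert (v \<tau>) \<tau>)"
  assumes d: "d \<ge> 1" and v: "\<And>\<tau>. \<tau> \<in> T \<Longrightarrow> v \<tau> \<in> {1..n} - \<tau>"
  shows "real (homology_dim d (one_out_complex d n v))
    \<le> 2 * real (card T) * ln (real (Suc d)) / harm (2 * k + 2)
      + 2 * real (card (stale_walks T S d (2 * k + 2)))"
proof (rule homology_dim_le_orthogonal_bound)
  let ?K = "one_out_complex d n v"
  have T: "finite T" "\<And>r. r \<in> T \<Longrightarrow> card r = d" "\<And>r. r \<in> T \<Longrightarrow> finite r"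
  proof -
    show "finite T" unfolding T_def by (rule finite_subset[of _ "Pow {1..n}"]) auto
    show "finite r" if "r \<in> T" for r
      using that finite_subset[of r "{1..n}"] by (simp add: T_def)
  qed (simp add: T_def)
  have S: "finite (S x) \<and> card (S x) = Suc d \<and> x \<subseteq> S x" "S x \<subseteq> {1..n}" if "x \<in> T" for x
  proof -
    have x: "x \<subseteq> {1..n}" using that by (simp add: T_def)
    have vx: "v x \<in> {1..n}" "v x \<notin> x" using v[OF that] by auto
    show "finite (S x) \<and> card (S x) = Suc d \<and> x \<subseteq> S x"
      using T(2,3)[OF that] vx(2) by (simp add: S_def subset_insertI)
    show "S x \<subseteq> {1..n}" using x vx(1) by (simp add: S_def)
  qed
  have K: "?K = {\<sigma>. \<sigma> \<subseteq> {1..n} \<and> \<sigma> \<noteq> {} \<and> card \<sigma> \<le> d} \<union> S ` T"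
    by (simp add: one_out_complex_def S_def T_def setcompr_eq_image)
  have card_S: "card \<sigma> = Suc d" if "\<sigma> \<in> S ` T" for \<sigma> using that S(1) by auto
  have FK: "faces ?K d = S ` T"
    unfolding faces_def K using card_S by auto
  show "faces ?K (d + 1) = {}"
    unfolding faces_def K using card_S by auto
  show fin: "finite (faces ?K d)" unfolding FK using T by simp
  fix A assume A: "finite A" "A \<subseteq> cycles ?K d - {0}"
    and orth: "\<And>c c'. c \<in> A \<Longrightarrow> c' \<in> A \<Longrightarrow> c \<noteq> c' \<Longrightarrow>
        (\<Sum>\<sigma>\<in>faces ?K d. Poly_Mapping.lookup c \<sigma> * Poly_Mapping.lookup c' \<sigma>) = 0"
  \<comment> \<open>\<open>T'\<close> picks one choosing \<open>(d-1)\<close>-face for each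
    \<open>d\<close>-face. As \<open>z\<close> vanishes outside \<open>T'\<close>, sums over columns
    against \<open>z\<close> become sums over \<open>d\<close>-faces.\<close>
  obtain T' where T': "T' \<subseteq> T" "inj_on S T'" "S ` T' = S ` T"
    using subset_image_inj[of "S ` T" S T] by auto
  define z where "z = (\<lambda>c \<tau>. if \<tau> \<in> T' then real_of_rat (Poly_Mapping.lookup c (S \<tau>)) else 0)"
  define inc :: "nat set \<Rightarrow> nat set \<Rightarrow> rat" where
    "inc = (\<lambda>r \<sigma>. if r \<subseteq> \<sigma> then (-1) ^ card {u \<in> \<sigma>. u < the_elem (\<sigma> - r)} else 0)"
  define a where "a = (\<lambda>r \<tau>. real_of_rat (inc r (S \<tau>)))"
  \<comment> \<open>The degree counts columns, hence repeated \<open>d\<close>-faces with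
    multiplicity.\<close>
  define g where "g = (\<lambda>r. 1 / (real (Suc d) * real (card {x \<in> T. r \<subseteq> S x})))"
  have sum_z: "(\<Sum>\<tau>\<in>T. f (S \<tau>) * z c \<tau>) = (\<Sum>\<sigma>\<in>S ` T. f \<sigma> * real_of_rat (Poly_Mapping.lookup c \<sigma>))"
    for f c
  proof -
    have "(\<Sum>\<tau>\<in>T. f (S \<tau>) * z c \<tau>) = (\<Sum>\<tau>\<in>T'. f (S \<tau>) * real_of_rat (Poly_Mapping.lookup c (S \<tau>)))"
      using T T' by (intro sum.mono_neutral_cong_right) (auto simp: z_def)
    then show ?thesis unfolding T'(3)[symmetric] by (simp add: sum.reindex[OF T'(2)])
  qed
  have zz: "(\<Sum>\<tau>\<in>T. z c \<tau> * z c' \<tau>)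
      = real_of_rat (\<Sum>\<sigma>\<in>S ` T. Poly_Mapping.lookup c \<sigma> * Poly_Mapping.lookup c' \<sigma>)" for c c'
  proof -
    have "(\<Sum>\<tau>\<in>T. z c \<tau> * z c' \<tau>) = (\<Sum>\<tau>\<in>T. real_of_rat (Poly_Mapping.lookup c (S \<tau>)) * z c' \<tau>)"
      by (intro sum.cong) (auto simp: z_def)
    then show ?thesis using sum_z[of "\<lambda>\<sigma>. real_of_rat (Poly_Mapping.lookup c \<sigma>)" c']
      by (simp add: of_rat_sum of_rat_mult)
  qed
  have keys: "Poly_Mapping.keys c \<subseteq> S ` T" if "c \<in> A" for c
    using that A FK by (auto simp: cycles_def chains_def)
  have "real (card A) \<le> (\<Sum>x\<in>T. kpow T (cogram T a g) (Suc k + Suc k) x x)"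
  proof (rule card_orthogonal_kernel_le_trace[OF T(1) A(1)])
    show "(\<Sum>x\<in>T. z c x * z c' x) = 0" if "c \<in> A" "c' \<in> A" "c \<noteq> c'" for c c'
      using orth[OF that] by (simp add: zz FK)
    show "(\<Sum>x\<in>T. z c x * z c x) > 0" if c: "c \<in> A" for c
    proof -
      have "c \<noteq> 0" using A c by auto
      then obtain \<sigma> where \<sigma>: "Poly_Mapping.lookup c \<sigma> \<noteq> 0"
        by (metis lookup_zero poly_mapping_eqI)
      then have "\<sigma> \<in> S ` T" using keys[OF c] by (auto simp: in_keys_iff)
      then have "(\<Sum>\<sigma>\<in>S ` T. Poly_Mapping.lookup c \<sigma> * Poly_Mapping.lookup c \<sigma>) > 0"
        using T(1) \<sigma> by (intro sum_pos2[of _ \<sigma>]) (auto simp: zero_less_mult_iff)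
      then show ?thesis by (simp add: zz)
    qed
    show "(\<Sum>x\<in>T. a r x * z c x) = 0" if c: "c \<in> A" and r: "r \<in> T" for c r
    proof -
      have "boundary d c = 0" using A c by (auto simp: cycles_def)
      then have "0 = (\<Sum>\<sigma>\<in>S ` T. Poly_Mapping.lookup c \<sigma> * inc r \<sigma>)"
        using lookup_boundary_facet[of "S ` T" c r d] keys[OF c] T r d S
        by (auto simp: inc_def)
      then have "0 = real_of_rat (\<Sum>\<sigma>\<in>S ` T. Poly_Mapping.lookup c \<sigma> * inc r \<sigma>)" by simp
      also have "\<dots> = (\<Sum>x\<in>T. a r x * z c x)"
        unfolding a_def sum_z[of "\<lambda>\<sigma>. real_of_rat (inc r \<sigma>)"]
        by (simp add: of_rat_sum of_rat_mult mult.commute)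
      finally show ?thesis by simp
    qed
  qed
  also have "Suc k + Suc k = Suc (2 * k + 1)" by simp
  also have "(\<Sum>x\<in>T. kpow T (cogram T a g) (Suc (2 * k + 1)) x x)
    \<le> 2 * real (card T) * ln (real (Suc d)) / harm (Suc (2 * k + 1))
      + 2 * real (card (stale_walks T S d (Suc (2 * k + 1))))"
  proof (rule trace_le_ln_over_harm)
    show "r \<in> T" if "x \<in> T" "r \<subseteq> S x" "card r = d" for x r
      using S(2)[OF that(1)] that by (auto simp: T_def)
    show "\<bar>a r x\<bar> = (if r \<subseteq> S x then 1 else 0)" for r x
      by (simp add: a_def inc_def of_rat_power of_rat_minus power_abs)
  qed (use T S in \<open>auto simp: g_def\<close>)
  finally show "real (card A) \<le> 2 * real (card T) * ln (real (Suc d)) / harm (2 * k + 2)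
      + 2 * real (card (stale_walks T S d (2 * k + 2)))"
    by simp
qed

section \<open>The expected number of stale walks\<close>

lemma expectation_finite_mono:
  fixes f g :: "'a \<Rightarrow> real"
  assumes "finite (set_pmf p)" "\<And>v. v \<in> set_pmf p \<Longrightarrow> f v \<le> g v"
  shows "measure_pmf.expectation p f \<le> measure_pmf.expectation p g"
  using assms by (intro integral_mono_AE integrable_measure_pmf_finite) (auto simp: AE_measure_pmf_iff)

lemma expectation_finite_sum:
  fixes f :: "'i \<Rightarrow> 'a \<Rightarrow> real"
  assumes "finite (set_pmf p)"
  shows "measure_pmf.expectation p (\<lambda>v. \<Sum>i\<in>I. f i v) = (\<Sum>i\<in>I. measure_pmf.expectation p (f i))"
  using assms by (intro Bochner_Integration.integral_sum integrable_measure_pmf_finite)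

text \<open>In a product law a coordinate may be replaced by a fresh copy: after splitting off
  coordinate \<open>x\<close>, its first value is overwritten by an independent second one with the
  same law.\<close>

lemma Pi_pmf_resample:
  assumes "finite A" "x \<in> A"
  shows "Pi_pmf A dflt q = bind_pmf (Pi_pmf A dflt q) (\<lambda>f. map_pmf (\<lambda>y. f(x := y)) (q x))"
proof -
  have A: "A = insert x (A - {x})" using assms by blast
  have "bind_pmf (Pi_pmf A dflt q) (\<lambda>f. map_pmf (\<lambda>y. f(x := y)) (q x))
      = do {_ \<leftarrow> q x; f \<leftarrow> Pi_pmf (A - {x}) dflt q; y \<leftarrow> q x; return_pmf (f(x := y))}"
    by (subst A, subst Pi_pmf_insert')
      (use assms in \<open>auto simp: map_pmf_def bind_assoc_pmf bind_return_pmf\<close>)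
  also have "\<dots> = do {y \<leftarrow> q x; f \<leftarrow> Pi_pmf (A - {x}) dflt q; return_pmf (f(x := y))}"
    by (simp add: bind_commute_pmf[of "Pi_pmf (A - {x}) dflt q"])
  also have "\<dots> = Pi_pmf A dflt q"
    by (subst (2) A, subst Pi_pmf_insert') (use assms in auto)
  finally show ?thesis by simp
qed

lemma expectation_Pi_pmf_resample:
  fixes h :: "('a \<Rightarrow> 'b) \<Rightarrow> real" and dflt :: 'b
  assumes A: "finite A" "x \<in> A" and B: "\<And>x. x \<in> A \<Longrightarrow> finite (B x) \<and> B x \<noteq> {}"
  defines "p \<equiv> Pi_pmf A dflt (\<lambda>x. pmf_of_set (B x))"
  shows "measure_pmf.expectation p h
    = measure_pmf.expectation p (\<lambda>f. (\<Sum>y\<in>B x. h (f(x := y))) / real (card (B x)))"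
proof -
  have fin: "finite (set_pmf p)"
    unfolding p_def using A B by (auto simp: set_Pi_pmf intro!: finite_PiE_dflt)
  have "measure_pmf.expectation p h = measure_pmf.expectation
      (bind_pmf p (\<lambda>f. map_pmf (\<lambda>y. f(x := y)) (pmf_of_set (B x)))) h"
    using Pi_pmf_resample[OF A, of dflt "\<lambda>x. pmf_of_set (B x)"] unfolding p_def by simp
  also have "\<dots> = (\<Sum>f\<in>set_pmf p. pmf p f *
      measure_pmf.expectation (map_pmf (\<lambda>y. f(x := y)) (pmf_of_set (B x))) h)"
    by (subst pmf_expectation_bind[OF fin]) (use A B in auto)
  also have "\<dots> = (\<Sum>f\<in>set_pmf p. ((\<Sum>y\<in>B x. h (f(x := y))) / real (card (B x))) * pmf p f)"
    using A B by (intro sum.cong refl) (auto simp: integral_pmf_of_set)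
  also have "\<dots> = measure_pmf.expectation p (\<lambda>f. (\<Sum>y\<in>B x. h (f(x := y))) / real (card (B x)))"
    by (rule integral_measure_pmf_real[OF fin, symmetric]) auto
  finally show ?thesis .
qed

text \<open>A set \<open>insert x \<tau>\<close> sharing \<open>d\<close> vertices with
  \<open>\<sigma>\<close> arises by exchanging some \<open>u \<in> \<sigma>\<close> for some
  \<open>y \<in> X\<close>, and then \<open>x\<close> is \<open>y\<close> or a vertex of
  \<open>\<sigma> - {u}\<close>. Only \<open>y\<close> ranges over all of \<open>X\<close>, so the
  count is linear in \<open>card X\<close>.\<close>

lemma card_near_facets_le:
  fixes \<sigma> :: "'v set"
  assumes X: "finite X" and \<sigma>: "finite \<sigma>" "card \<sigma> = Suc d"
  shows "card {(\<tau>, x). \<tau> \<subseteq> X \<and> card \<tau> = d \<and> x \<in> X - \<tau> \<and> d \<le> card (insert x \<tau> \<inter> \<sigma>)}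
    \<le> Suc d * Suc d * card X" (is "card ?P \<le> _")
proof -
  \<comment> \<open>\<open>w\<close> names \<open>x\<close>. The value \<open>w = u\<close>, which
    no vertex of \<open>\<sigma> - {u}\<close> can take, encodes the case
    \<open>x = y\<close>.\<close>
  define h where "h = (\<lambda>(u, w, y). (insert y (\<sigma> - {u}) - {if w = u then y else w}, if w = u then y else w))"
  have sub: "?P \<subseteq> h ` (\<sigma> \<times> \<sigma> \<times> X)"
  proof (rule subsetI)
    fix z assume "z \<in> ?P"
    then obtain \<tau> x where z: "z = (\<tau>, x)" and \<tau>: "\<tau> \<subseteq> X" "card \<tau> = d" "x \<in> X" "x \<notin> \<tau>"
      and c: "d \<le> card (insert x \<tau> \<inter> \<sigma>)"
      by blast
    have fin: "finite \<tau>" using \<tau>(1) X finite_subset by blast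
    obtain R where R: "R \<subseteq> insert x \<tau> \<inter> \<sigma>" "card R = d"
      using obtain_subset_with_card_n[OF c] by blast
    have finR: "finite R" using R(1) \<sigma>(1) finite_subset by blast
    have "R \<subseteq> \<sigma>" using R by blast
    then have "card (\<sigma> - R) = 1" using R(2) \<sigma> finR by (simp add: card_Diff_subset)
    then obtain u where u: "\<sigma> - R = {u}" by (auto simp: card_1_singleton_iff)
    have "card (insert x \<tau>) = Suc d" using \<tau> fin by simp
    moreover have "R \<subseteq> insert x \<tau>" using R by blast
    ultimately have "card (insert x \<tau> - R) = 1" using R(2) finR by (simp add: card_Diff_subset)
    then obtain y where y: "insert x \<tau> - R = {y}" by (auto simp: card_1_singleton_iff)
    have Ru: "R = \<sigma> - {u}" "u \<in> \<sigma>" using u \<open>R \<subseteq> \<sigma>\<close> by blast+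
    have yx: "y \<in> insert x \<tau>" using y by blast
    have "insert x \<tau> = insert y R" using y \<open>R \<subseteq> insert x \<tau>\<close> by blast
    then have eq: "insert x \<tau> = insert y (\<sigma> - {u})" "y \<in> X" using Ru yx \<tau>(1,3) by auto
    have "x \<in> insert y (\<sigma> - {u})" unfolding eq(1)[symmetric] by simp
    then have xy: "x = y \<or> x \<in> \<sigma> - {u}" by simp
    have \<tau>_eq: "\<tau> = insert y (\<sigma> - {u}) - {x}" unfolding eq(1)[symmetric] using \<tau>(4) by simp
    show "z \<in> h ` (\<sigma> \<times> \<sigma> \<times> X)"
    proof (cases "x = y")
      case True
      then have "z = h (u, u, y)" using \<tau>_eq z by (simp add: h_def)
      then show ?thesis using Ru(2) eq(2) by (intro image_eqI) auto
    next
      case False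
      with xy have x: "x \<in> \<sigma>" "x \<noteq> u" by auto
      then have "z = h (u, x, y)" using \<tau>_eq z by (simp add: h_def)
      then show ?thesis using Ru(2) eq(2) x(1) by (intro image_eqI) auto
    qed
  qed
  have fin: "finite (\<sigma> \<times> \<sigma> \<times> X)" using X \<sigma> by simp
  have "card ?P \<le> card (h ` (\<sigma> \<times> \<sigma> \<times> X))" using sub fin by (intro card_mono) auto
  also have "\<dots> \<le> card (\<sigma> \<times> \<sigma> \<times> X)" using fin by (rule card_image_le)
  finally show "card ?P \<le> Suc d * Suc d * card X"
    using \<sigma> by (simp add: card_cartesian_product mult.assoc del: mult_Suc mult_Suc_right)
qed


section \<open>Extending random walks by one column\<close>

definition ridges :: "nat \<Rightarrow> nat \<Rightarrow> nat set set" where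
  "ridges d n = {\<tau>. \<tau> \<subseteq> {1..n} \<and> card \<tau> = d}"

definition cell :: "('v set \<Rightarrow> 'v) \<Rightarrow> 'v set \<Rightarrow> 'v set" where
  "cell v \<tau> = insert (v \<tau>) \<tau>"

definition choice_pmf :: "nat \<Rightarrow> nat \<Rightarrow> (nat set \<Rightarrow> nat) pmf" where
  "choice_pmf d n = Pi_pmf (ridges d n) 0 (\<lambda>\<tau>. pmf_of_set ({1..n} - \<tau>))"

lemma finite_ridges: "finite (ridges d n)"
  unfolding ridges_def by (rule finite_subset[of _ "Pow {1..n}"]) auto

lemma card_ridges_le: "card (ridges d n) \<le> n ^ d"
proof -
  have "card (ridges d n) = n choose d" by (simp add: ridges_def n_subsets)
  then show ?thesis by (cases "d \<le> n") (simp_all add: binomial_le_pow binomial_eq_0)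
qed

lemma ridgesD:
  assumes "\<tau> \<in> ridges d n"
  shows "finite \<tau>" "card \<tau> = d" "card ({1..n} - \<tau>) = n - d" "\<tau> \<subseteq> {1..n}"
proof -
  show t: "\<tau> \<subseteq> {1..n}" "card \<tau> = d" using assms by (auto simp: ridges_def)
  show f: "finite \<tau>" using t(1) finite_subset by blast
  show "card ({1..n} - \<tau>) = n - d" using t f by (simp add: card_Diff_subset)
qed

lemma ridges_complement:
  assumes "d < n" "\<tau> \<in> ridges d n"
  shows "finite ({1..n} - \<tau>) \<and> {1..n} - \<tau> \<noteq> {}"
proof -
  have "card ({1..n} - \<tau>) \<noteq> 0" using ridgesD(3)[OF assms(2)] assms(1) by simp
  then show ?thesis by (metis card.empty finite_Diff finite_atLeastAtMost)
qed

text \<open>For \<open>d < n\<close> every ridge has a nonempty complement, so the uniform laws are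
  genuine and have the expected supports.\<close>

lemma set_choice_pmf:
  assumes "d < n"
  shows "finite (set_pmf (choice_pmf d n))"
    and "v \<in> set_pmf (choice_pmf d n) \<Longrightarrow> \<tau> \<in> ridges d n \<Longrightarrow> v \<tau> \<in> {1..n} - \<tau>"
proof -
  have s: "set_pmf (choice_pmf d n) = PiE_dflt (ridges d n) 0 (\<lambda>\<tau>. {1..n} - \<tau>)"
    unfolding choice_pmf_def set_Pi_pmf[OF finite_ridges] PiE_dflt_def
    using ridges_complement[OF assms] by (auto simp: set_pmf_of_set)
  show "finite (set_pmf (choice_pmf d n))"
    unfolding s by (intro finite_PiE_dflt finite_ridges) auto
  show "v \<in> set_pmf (choice_pmf d n) \<Longrightarrow> \<tau> \<in> ridges d n \<Longrightarrow> v \<tau> \<in> {1..n} - \<tau>"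
    unfolding s PiE_dflt_def by auto
qed

text \<open>
  Extending a walk by a column whose vertex has not been revealed yet: for given \<open>\<tau>\<close> the new vertex
  is uniform, independently of the walk, so it suffices to count the pairs \<open>(\<tau>, x)\<close>.
\<close>

lemma expectation_extend_le:
  fixes Q :: "(nat set \<Rightarrow> nat) \<Rightarrow> bool" and P :: "(nat set \<Rightarrow> nat) \<Rightarrow> nat set \<Rightarrow> bool"
  assumes n: "d < n"
    and Q: "\<And>v \<tau> x. \<tau> \<notin> U \<Longrightarrow> Q (v(\<tau> := x)) = Q v"
    and P: "\<And>v \<tau> x. \<tau> \<notin> U \<Longrightarrow> P (v(\<tau> := x)) = P v"
    and M: "\<And>v. v \<in> set_pmf (choice_pmf d n) \<Longrightarrow>
      card {(\<tau>, x). \<tau> \<in> ridges d n \<and> x \<in> {1..n} - \<tau> \<and> P v (insert x \<tau>)} \<le> M"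
  shows "(\<Sum>\<tau>\<in>ridges d n - U. measure_pmf.expectation (choice_pmf d n)
        (\<lambda>v. of_bool (Q v \<and> P v (cell v \<tau>))))
    \<le> real M / real (n - d) * measure_pmf.expectation (choice_pmf d n) (\<lambda>v. of_bool (Q v))"
proof -
  let ?E = "measure_pmf.expectation (choice_pmf d n) :: (_ \<Rightarrow> real) \<Rightarrow> real"
  let ?T = "ridges d n" and ?B = "\<lambda>\<tau>. {1..n} - \<tau>"
  have "?E (\<lambda>v. of_bool (Q v \<and> P v (cell v \<tau>)))
      = ?E (\<lambda>v. (\<Sum>x\<in>?B \<tau>. of_bool (Q v \<and> P v (insert x \<tau>))) / real (n - d))"
    if \<tau>: "\<tau> \<in> ?T - U" for \<tau>
  proof -
    have "?E (\<lambda>v. of_bool (Q v \<and> P v (cell v \<tau>))) = ?E (\<lambda>v. (\<Sum>x\<in>?B \<tau>.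
        of_bool (Q (v(\<tau> := x)) \<and> P (v(\<tau> := x)) (cell (v(\<tau> := x)) \<tau>))) / real (card (?B \<tau>)))"
      unfolding choice_pmf_def
      by (rule expectation_Pi_pmf_resample[OF finite_ridges])
        (use \<tau> ridges_complement[OF n] in auto)
    then show ?thesis using \<tau> ridgesD(3)[of \<tau> d n] by (simp add: Q P cell_def del: sum_of_bool_eq)
  qed
  then have "(\<Sum>\<tau>\<in>?T - U. ?E (\<lambda>v. of_bool (Q v \<and> P v (cell v \<tau>))))
      = (\<Sum>\<tau>\<in>?T - U. ?E (\<lambda>v. (\<Sum>x\<in>?B \<tau>. of_bool (Q v \<and> P v (insert x \<tau>))) / real (n - d)))"
    by (rule sum.cong[OF refl])
  also have "\<dots> = ?E (\<lambda>v. \<Sum>\<tau>\<in>?T - U. (\<Sum>x\<in>?B \<tau>. of_bool (Q v \<and> P v (insert x \<tau>))) / real (n - d))"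
    by (rule expectation_finite_sum[OF set_choice_pmf(1)[OF n], symmetric])
  also have "\<dots> \<le> ?E (\<lambda>v. real M / real (n - d) * of_bool (Q v))"
  proof (rule expectation_finite_mono[OF set_choice_pmf(1)[OF n]])
    fix v assume v: "v \<in> set_pmf (choice_pmf d n)"
    let ?G = "{(\<tau>, x). \<tau> \<in> ?T \<and> x \<in> ?B \<tau> \<and> P v (insert x \<tau>)}"
    have G: "finite ?G"
      by (rule finite_subset[of _ "?T \<times> {1..n}"]) (auto simp: finite_ridges)
    have "(\<Sum>\<tau>\<in>?T - U. \<Sum>x\<in>?B \<tau>. of_bool (Q v \<and> P v (insert x \<tau>)))
        = (of_bool (Q v) :: real) * (\<Sum>\<tau>\<in>?T - U. \<Sum>x\<in>?B \<tau>. of_bool (P v (insert x \<tau>)))"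
      by (simp add: sum_distrib_left of_bool_conj)
    also have "(\<Sum>\<tau>\<in>?T - U. \<Sum>x\<in>?B \<tau>. of_bool (P v (insert x \<tau>)))
        = (\<Sum>(\<tau>, x)\<in>Sigma (?T - U) ?B. of_bool (P v (insert x \<tau>)))"
      by (rule sum.Sigma) (auto simp: finite_ridges)
    also have "\<dots> = (\<Sum>(\<tau>, x)\<in>Sigma (?T - U) ?B \<inter> ?G. 1)"
      by (rule sum.mono_neutral_cong_right)
        (auto simp: finite_ridges intro!: finite_SigmaI)
    also have "\<dots> \<le> real (card ?G)"
      using G by (simp add: case_prod_unfold card_mono)
    also have "\<dots> \<le> real M" using M[OF v] by simp
    finally have "(\<Sum>\<tau>\<in>?T - U. \<Sum>x\<in>?B \<tau>. of_bool (Q v \<and> P v (insert x \<tau>)))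
        \<le> of_bool (Q v) * real M"
      by (simp add: mult_left_mono)
    then show "(\<Sum>\<tau>\<in>?T - U. (\<Sum>x\<in>?B \<tau>. of_bool (Q v \<and> P v (insert x \<tau>))) / real (n - d))
        \<le> real M / real (n - d) * of_bool (Q v)"
      by (simp add: sum_divide_distrib[symmetric] divide_right_mono mult.commute)
  qed
  finally show ?thesis by simp
qed

lemma card_cell:
  assumes "d < n" "v \<in> set_pmf (choice_pmf d n)" "\<tau> \<in> ridges d n"
  shows "finite (cell v \<tau>)" "card (cell v \<tau>) = Suc d"
  using set_choice_pmf(2)[OF assms] ridgesD[OF assms(3)] by (simp_all add: cell_def)

definition adjacent_walk :: "nat \<Rightarrow> ('v set \<Rightarrow> 'v) \<Rightarrow> 'v set list \<Rightarrow> bool" where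
  "adjacent_walk d v = successively (\<lambda>x y. d \<le> card (cell v x \<inter> cell v y))"

text \<open>A new choice at \<open>\<tau>\<close> alters the cell of \<open>\<tau>\<close> only.
  Events about a walk avoiding \<open>\<tau>\<close> are therefore unaffected, which is the form of
  independence that \<open>expectation_extend_le\<close> asks for.\<close>

lemma cell_update: "\<tau> \<noteq> \<sigma> \<Longrightarrow> cell (v(\<tau> := x)) \<sigma> = cell v \<sigma>"
  by (simp add: cell_def)

lemma image_cell_update: "\<tau> \<notin> U \<Longrightarrow> cell (v(\<tau> := x)) ` U = cell v ` U"
  by (intro image_cong refl cell_update) auto

lemma adjacent_walk_update:
  "\<tau> \<notin> set us \<Longrightarrow> adjacent_walk d (v(\<tau> := x)) us = adjacent_walk d v us"
proof -
  assume "\<tau> \<notin> set us"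
  then have "cell (v(\<tau> := x)) \<sigma> = cell v \<sigma>" if "\<sigma> \<in> set us" for \<sigma>
    using that by (intro cell_update) auto
  then show ?thesis unfolding adjacent_walk_def by (intro successively_cong) auto
qed

lemma stale_update: "\<tau> \<notin> set us \<Longrightarrow> stale (cell (v(\<tau> := x))) us = stale (cell v) us"
  by (induction us) (auto simp: cell_update image_cell_update)

text \<open>The expected number of adjacent extensions is bounded independently of \<open>n\<close>.
  Returning to a visited column accounts for \<open>length us\<close>. For a new column there are at
  most \<open>(d + 1)^2 * n\<close> pairs of a ridge and a vertex, each realised with probability
  \<open>1 / (n - d)\<close>, and \<open>n \<le> 2 * (n - d)\<close>.\<close>

lemma expectation_extend_adjacent_le:
  fixes Q :: "(nat set \<Rightarrow> nat) \<Rightarrow> bool"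
  assumes n: "2 * d \<le> n" "1 \<le> d" and us: "us \<noteq> []" "set us \<subseteq> ridges d n"
    and Q: "\<And>v \<tau> x. \<tau> \<notin> set us \<Longrightarrow> Q (v(\<tau> := x)) = Q v"
  shows "(\<Sum>\<tau>\<in>ridges d n. measure_pmf.expectation (choice_pmf d n)
        (\<lambda>v. of_bool (Q v \<and> d \<le> card (cell v \<tau> \<inter> cell v (hd us)))))
    \<le> (real (length us) + 2 * (real (Suc d))\<^sup>2) * measure_pmf.expectation (choice_pmf d n) (\<lambda>v. of_bool (Q v))"
proof -
  let ?E = "measure_pmf.expectation (choice_pmf d n) :: (_ \<Rightarrow> real) \<Rightarrow> real"
  let ?f = "\<lambda>\<tau>. ?E (\<lambda>v. of_bool (Q v \<and> d \<le> card (cell v \<tau> \<inter> cell v (hd us))))"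
  have dn: "d < n" using n by simp
  have hd: "hd us \<in> set us" using us by simp
  have E0: "?E (\<lambda>v. of_bool (Q v)) \<ge> 0" by simp
  have "(\<Sum>\<tau>\<in>ridges d n. ?f \<tau>) = (\<Sum>\<tau>\<in>set us. ?f \<tau>) + (\<Sum>\<tau>\<in>ridges d n - set us. ?f \<tau>)"
    using us by (subst sum.subset_diff[of "set us"]) (auto simp: finite_ridges)
  also have "(\<Sum>\<tau>\<in>set us. ?f \<tau>) \<le> (\<Sum>\<tau>\<in>set us. ?E (\<lambda>v. of_bool (Q v)))"
    by (intro sum_mono expectation_finite_mono set_choice_pmf dn) auto
  also have "\<dots> = real (card (set us)) * ?E (\<lambda>v. of_bool (Q v))" by simp
  also have "\<dots> \<le> real (length us) * ?E (\<lambda>v. of_bool (Q v))"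
    using E0 card_length[of us] by (intro mult_right_mono) auto
  also have "(\<Sum>\<tau>\<in>ridges d n - set us. ?f \<tau>)
      \<le> real (Suc d * Suc d * n) / real (n - d) * ?E (\<lambda>v. of_bool (Q v))"
  proof (rule expectation_extend_le[OF dn, where P = "\<lambda>v \<sigma>. d \<le> card (\<sigma> \<inter> cell v (hd us))"])
    show "Q (v(\<tau> := x)) = Q v" if "\<tau> \<notin> set us" for v \<tau> x using Q that .
    show "(\<lambda>\<sigma>. d \<le> card (\<sigma> \<inter> cell (v(\<tau> := x)) (hd us))) = (\<lambda>\<sigma>. d \<le> card (\<sigma> \<inter> cell v (hd us)))"
      if "\<tau> \<notin> set us" for v \<tau> x
      using hd that by (subst cell_update) auto
    fix v assume v: "v \<in> set_pmf (choice_pmf d n)"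
    have "hd us \<in> ridges d n" using hd us by blast
    from card_near_facets_le[OF finite_atLeastAtMost[of 1 n] card_cell[OF dn v this]]
    show "card {(\<tau>, x). \<tau> \<in> ridges d n \<and> x \<in> {1..n} - \<tau> \<and> d \<le> card (insert x \<tau> \<inter> cell v (hd us))}
        \<le> Suc d * Suc d * n"
      by (simp add: ridges_def conj_assoc)
  qed
  also have "real (Suc d * Suc d * n) / real (n - d) \<le> 2 * (real (Suc d))\<^sup>2"
  proof -
    have "real n \<le> 2 * real (n - d)" using n by linarith
    then have "real (Suc d * Suc d) * real n \<le> real (Suc d * Suc d) * (2 * real (n - d))"
      by (intro mult_left_mono) auto
    moreover have "0 < real (n - d)" using dn by simp
    ultimately show ?thesis
      by (simp only: pos_divide_le_eq of_nat_mult power2_eq_square mult_ac)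
  qed
  finally show ?thesis
    using E0 by (simp add: algebra_simps mult_right_mono)
qed

text \<open>A new stale column has its ridge and its chosen vertex among the at most
  \<open>length us * (d + 1)\<close> vertices already visited. The number of such pairs does not
  depend on \<open>n\<close>, and each is realised with probability \<open>1 / (n - d)\<close>; this
  gains a factor of order \<open>1 / n\<close>.\<close>

lemma expectation_extend_stale_le:
  fixes Q :: "(nat set \<Rightarrow> nat) \<Rightarrow> bool"
  assumes n: "d < n" and us: "set us \<subseteq> ridges d n"
    and Q: "\<And>v \<tau> x. \<tau> \<notin> set us \<Longrightarrow> Q (v(\<tau> := x)) = Q v"
  shows "(\<Sum>\<tau>\<in>ridges d n. measure_pmf.expectation (choice_pmf d n)
        (\<lambda>v. of_bool (Q v \<and> \<tau> \<notin> set us \<and> cell v \<tau> \<subseteq> \<Union>(cell v ` set us))))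
    \<le> real (2 ^ (length us * Suc d) * (length us * Suc d)) / real (n - d)
      * measure_pmf.expectation (choice_pmf d n) (\<lambda>v. of_bool (Q v))"
proof -
  let ?E = "measure_pmf.expectation (choice_pmf d n) :: (_ \<Rightarrow> real) \<Rightarrow> real"
  let ?P = "\<lambda>v \<sigma>. \<sigma> \<subseteq> \<Union>(cell v ` set us)"
  have "(\<Sum>\<tau>\<in>ridges d n. ?E (\<lambda>v. of_bool (Q v \<and> \<tau> \<notin> set us \<and> ?P v (cell v \<tau>))))
      = (\<Sum>\<tau>\<in>ridges d n - set us. ?E (\<lambda>v. of_bool (Q v \<and> ?P v (cell v \<tau>))))"
    by (rule sum.mono_neutral_cong_right) (auto simp: finite_ridges)
  also have "\<dots> \<le> real (2 ^ (length us * Suc d) * (length us * Suc d)) / real (n - d)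
      * ?E (\<lambda>v. of_bool (Q v))"
  proof (rule expectation_extend_le[OF n, where P = ?P])
    show "Q (v(\<tau> := x)) = Q v" if "\<tau> \<notin> set us" for v \<tau> x using Q that .
    show "?P (v(\<tau> := x)) = ?P v" if "\<tau> \<notin> set us" for v \<tau> x
      using that by (simp add: image_cell_update)
    fix v assume v: "v \<in> set_pmf (choice_pmf d n)"
    let ?V = "\<Union>(cell v ` set us)"
    have fin: "finite ?V" using card_cell(1)[OF n v] us by auto
    have "card ?V \<le> (\<Sum>\<tau>\<in>set us. card (cell v \<tau>))"
      by (rule card_UN_le) simp
    also have "\<dots> = (\<Sum>\<tau>\<in>set us. Suc d)"
      using card_cell(2)[OF n v] us by (intro sum.cong) auto
    also have "\<dots> \<le> length us * Suc d"
      using card_length[of us] by (simp del: mult_Suc_right)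
    finally have V: "card ?V \<le> length us * Suc d" .
    have "card {(\<tau>, x). \<tau> \<in> ridges d n \<and> x \<in> {1..n} - \<tau> \<and> insert x \<tau> \<subseteq> ?V}
        \<le> card (Pow ?V \<times> ?V)"
      using fin by (intro card_mono) auto
    also have "\<dots> = 2 ^ card ?V * card ?V"
      using fin by (simp add: card_cartesian_product card_Pow)
    also have "\<dots> \<le> 2 ^ (length us * Suc d) * (length us * Suc d)"
      using V by (intro mult_mono power_increasing) auto
    finally show "card {(\<tau>, x). \<tau> \<in> ridges d n \<and> x \<in> {1..n} - \<tau> \<and> insert x \<tau> \<subseteq> ?V}
        \<le> 2 ^ (length us * Suc d) * (length us * Suc d)" .
  qed
  finally show ?thesis .
qed


text \<open>A stale walk either was stale before its last column, which then costs a constant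
  factor, or becomes stale with it, which costs a factor of order \<open>1 / n\<close> relative to
  all adjacent walks. Hence both counts are bounded in the same induction.\<close>

lemma expectation_walk_bounds:
  assumes d: "1 \<le> d"
  defines "L \<equiv> \<lambda>k n. {us. set us \<subseteq> ridges d n \<and> length us = k}"
  shows "\<exists>C\<ge>0. \<forall>n\<ge>2 * d.
    (\<Sum>us\<in>L (Suc k) n. measure_pmf.expectation (choice_pmf d n)
      (\<lambda>v. of_bool (adjacent_walk d v us))) \<le> C * real (card (ridges d n)) \<and>
    (\<Sum>us\<in>L (Suc k) n. measure_pmf.expectation (choice_pmf d n)
      (\<lambda>v. of_bool (adjacent_walk d v us \<and> stale (cell v) us)))
      \<le> C * real (card (ridges d n)) / real (n - d)"
proof (induction k)
  case 0
  have L1: "L (Suc 0) n = (\<lambda>\<tau>. [\<tau>]) ` ridges d n" for n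
    unfolding L_def by (auto simp: length_Suc_conv)
  \<comment> \<open>A single column is trivially adjacent, and its cell, being nonempty, is not
    stale.\<close>
  show ?case
    by (intro exI[of _ 1])
      (auto simp: L1 sum.reindex inj_on_def adjacent_walk_def cell_def)
next
  case (Suc k)
  then obtain C where C: "C \<ge> 0"
    and IH: "\<And>n. 2 * d \<le> n \<Longrightarrow>
    (\<Sum>us\<in>L (Suc k) n. measure_pmf.expectation (choice_pmf d n)
      (\<lambda>v. of_bool (adjacent_walk d v us))) \<le> C * real (card (ridges d n))"
    "\<And>n. 2 * d \<le> n \<Longrightarrow>
    (\<Sum>us\<in>L (Suc k) n. measure_pmf.expectation (choice_pmf d n)
      (\<lambda>v. of_bool (adjacent_walk d v us \<and> stale (cell v) us)))
      \<le> C * real (card (ridges d n)) / real (n - d)"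
    by blast
  define K where "K = real (Suc k) + 2 * (real (Suc d))\<^sup>2"
  define D where "D = real (2 ^ (Suc k * Suc d) * (Suc k * Suc d))"
  have KD: "K \<ge> 0" "D \<ge> 0" by (simp_all add: K_def D_def)
  \<comment> \<open>\<open>K * C\<close> pays for extending a walk, \<open>D * C\<close> for walks
    becoming stale with the last column; one constant serves both bounds.\<close>
  show ?case
  proof (intro exI[of _ "K * C + D * C"] conjI allI impI)
    show "K * C + D * C \<ge> 0" using C KD by simp
    fix n assume n: "2 * d \<le> n"
    then have dn: "d < n" using d by simp
    let ?E = "measure_pmf.expectation (choice_pmf d n) :: (_ \<Rightarrow> real) \<Rightarrow> real"
    let ?N = "real (card (ridges d n))"
    let ?adj = "\<lambda>v \<tau> us. d \<le> card (cell v \<tau> \<inter> cell v (hd us))"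
    let ?new = "\<lambda>v \<tau> us. \<tau> \<notin> set us \<and> cell v \<tau> \<subseteq> \<Union>(cell v ` set us)"
    have L: "us \<noteq> []" "set us \<subseteq> ridges d n" "length us = Suc k" if "us \<in> L (Suc k) n" for us
      using that by (auto simp: L_def)
    have sum_L: "(\<Sum>us\<in>L (Suc (Suc k)) n. f us) = (\<Sum>us\<in>L (Suc k) n. \<Sum>\<tau>\<in>ridges d n. f (\<tau> # us))"
      for f :: "_ \<Rightarrow> real"
      unfolding L_def lists_length_Suc_eq[of _ "Suc k"]
      by (subst sum.reindex) (auto simp: inj_on_def case_prod_unfold sum.cartesian_product)
    have adj_Cons: "adjacent_walk d v (\<tau> # us) \<longleftrightarrow> adjacent_walk d v us \<and> ?adj v \<tau> us"
      if "us \<noteq> []" for v \<tau> us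
      using that by (cases us) (auto simp: adjacent_walk_def)
    have W: "(\<Sum>us\<in>L (Suc k) n. \<Sum>\<tau>\<in>ridges d n. ?E (\<lambda>v. of_bool (Q v us \<and> ?adj v \<tau> us)))
        \<le> K * (\<Sum>us\<in>L (Suc k) n. ?E (\<lambda>v. of_bool (Q v us)))"
      if "\<And>v \<tau> x us. \<tau> \<notin> set us \<Longrightarrow> Q (v(\<tau> := x)) us = Q v us" for Q
      unfolding sum_distrib_left
    proof (rule sum_mono)
      fix us assume us: "us \<in> L (Suc k) n"
      show "(\<Sum>\<tau>\<in>ridges d n. ?E (\<lambda>v. of_bool (Q v us \<and> ?adj v \<tau> us)))
          \<le> K * ?E (\<lambda>v. of_bool (Q v us))"
        using expectation_extend_adjacent_le[OF n d L(1,2)[OF us], of "\<lambda>v. Q v us"] that L(3)[OF us]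
        by (simp add: K_def)
    qed
    have "(\<Sum>us\<in>L (Suc (Suc k)) n. ?E (\<lambda>v. of_bool (adjacent_walk d v us)))
        = (\<Sum>us\<in>L (Suc k) n. \<Sum>\<tau>\<in>ridges d n.
            ?E (\<lambda>v. of_bool (adjacent_walk d v us \<and> ?adj v \<tau> us)))"
      unfolding sum_L by (intro sum.cong refl) (simp add: adj_Cons L(1))
    also have "\<dots> \<le> K * (\<Sum>us\<in>L (Suc k) n. ?E (\<lambda>v. of_bool (adjacent_walk d v us)))"
      by (rule W) (rule adjacent_walk_update)
    also have "\<dots> \<le> K * (C * ?N)" by (intro mult_left_mono IH n KD)
    also have "\<dots> \<le> (K * C + D * C) * ?N" using C KD by (simp add: algebra_simps)
    finally show "(\<Sum>us\<in>L (Suc (Suc k)) n. ?E (\<lambda>v. of_bool (adjacent_walk d v us)))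
        \<le> (K * C + D * C) * ?N" .
    have "(\<Sum>us\<in>L (Suc (Suc k)) n. ?E (\<lambda>v. of_bool (adjacent_walk d v us \<and> stale (cell v) us)))
        \<le> (\<Sum>us\<in>L (Suc k) n. \<Sum>\<tau>\<in>ridges d n.
            ?E (\<lambda>v. of_bool ((adjacent_walk d v us \<and> stale (cell v) us) \<and> ?adj v \<tau> us))
            + ?E (\<lambda>v. of_bool (adjacent_walk d v us \<and> ?new v \<tau> us)))"
      unfolding sum_L
    proof (intro sum_mono)
      fix us \<tau> assume us: "us \<in> L (Suc k) n"
      \<comment> \<open>\<open>?f\<close> stands for staleness inherited from \<open>us\<close>,
        \<open>?g\<close> for staleness created by \<open>\<tau>\<close>; in \<open>?g\<close> the
        adjacency of \<open>\<tau>\<close> is given up.\<close>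
      let ?f = "\<lambda>v. of_bool ((adjacent_walk d v us \<and> stale (cell v) us) \<and> ?adj v \<tau> us) :: real"
      let ?g = "\<lambda>v. of_bool (adjacent_walk d v us \<and> ?new v \<tau> us) :: real"
      have "?E (\<lambda>v. of_bool (adjacent_walk d v (\<tau> # us) \<and> stale (cell v) (\<tau> # us)))
          \<le> ?E (\<lambda>v. ?f v + ?g v)"
        by (intro expectation_finite_mono set_choice_pmf dn) (auto simp: adj_Cons L(1)[OF us])
      also have "\<dots> = ?E ?f + ?E ?g"
        by (intro Bochner_Integration.integral_add integrable_measure_pmf_finite set_choice_pmf dn)
      finally show "?E (\<lambda>v. of_bool (adjacent_walk d v (\<tau> # us) \<and> stale (cell v) (\<tau> # us)))
          \<le> ?E ?f + ?E ?g" .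
    qed
    also have "\<dots> = (\<Sum>us\<in>L (Suc k) n. \<Sum>\<tau>\<in>ridges d n.
            ?E (\<lambda>v. of_bool ((adjacent_walk d v us \<and> stale (cell v) us) \<and> ?adj v \<tau> us)))
        + (\<Sum>us\<in>L (Suc k) n. \<Sum>\<tau>\<in>ridges d n.
            ?E (\<lambda>v. of_bool (adjacent_walk d v us \<and> ?new v \<tau> us)))"
      by (simp only: sum.distrib)
    also have "\<dots> \<le> K * (C * ?N / real (n - d)) + D / real (n - d) * (C * ?N)"
    proof (rule add_mono)
      have "(\<Sum>us\<in>L (Suc k) n. \<Sum>\<tau>\<in>ridges d n.
            ?E (\<lambda>v. of_bool ((adjacent_walk d v us \<and> stale (cell v) us) \<and> ?adj v \<tau> us)))
          \<le> K * (\<Sum>us\<in>L (Suc k) n. ?E (\<lambda>v. of_bool (adjacent_walk d v us \<and> stale (cell v) us)))"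
        by (rule W) (simp add: adjacent_walk_update stale_update)
      also have "\<dots> \<le> K * (C * ?N / real (n - d))" by (intro mult_left_mono IH n KD)
      finally show "(\<Sum>us\<in>L (Suc k) n. \<Sum>\<tau>\<in>ridges d n.
            ?E (\<lambda>v. of_bool ((adjacent_walk d v us \<and> stale (cell v) us) \<and> ?adj v \<tau> us)))
          \<le> K * (C * ?N / real (n - d))" .
      have "(\<Sum>us\<in>L (Suc k) n. \<Sum>\<tau>\<in>ridges d n.
            ?E (\<lambda>v. of_bool (adjacent_walk d v us \<and> ?new v \<tau> us)))
          \<le> (\<Sum>us\<in>L (Suc k) n. D / real (n - d) * ?E (\<lambda>v. of_bool (adjacent_walk d v us)))"
      proof (rule sum_mono)
        fix us assume us: "us \<in> L (Suc k) n"
        show "(\<Sum>\<tau>\<in>ridges d n. ?E (\<lambda>v. of_bool (adjacent_walk d v us \<and> ?new v \<tau> us)))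
            \<le> D / real (n - d) * ?E (\<lambda>v. of_bool (adjacent_walk d v us))"
          using expectation_extend_stale_le[OF dn L(2)[OF us],
              where Q = "\<lambda>v. adjacent_walk d v us", OF adjacent_walk_update]
          unfolding D_def L(3)[OF us] .
      qed
      also have "\<dots> \<le> D / real (n - d) * (C * ?N)"
        unfolding sum_distrib_left[symmetric] using KD by (intro mult_left_mono IH n) auto
      finally show "(\<Sum>us\<in>L (Suc k) n. \<Sum>\<tau>\<in>ridges d n.
            ?E (\<lambda>v. of_bool (adjacent_walk d v us \<and> ?new v \<tau> us)))
          \<le> D / real (n - d) * (C * ?N)" .
    qed
    also have "\<dots> = (K * C + D * C) * ?N / real (n - d)"
      by (simp add: add_divide_distrib algebra_simps)
    finally show "(\<Sum>us\<in>L (Suc (Suc k)) n.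
          ?E (\<lambda>v. of_bool (adjacent_walk d v us \<and> stale (cell v) us)))
        \<le> (K * C + D * C) * ?N / real (n - d)" .
  qed
qed

lemma expectation_stale_walks_le:
  assumes d: "1 \<le> d"
  shows "\<exists>C\<ge>0. \<forall>n\<ge>2 * d. measure_pmf.expectation (choice_pmf d n)
      (\<lambda>v. real (card (stale_walks (ridges d n) (cell v) d (Suc k))))
    \<le> C * real (card (ridges d n)) / real (n - d)"
proof -
  let ?L = "\<lambda>n. {us. set us \<subseteq> ridges d n \<and> length us = Suc k}"
  have "measure_pmf.expectation (choice_pmf d n)
      (\<lambda>v. real (card (stale_walks (ridges d n) (cell v) d (Suc k))))
    = (\<Sum>us\<in>?L n. measure_pmf.expectation (choice_pmf d n)
      (\<lambda>v. of_bool (adjacent_walk d v us \<and> stale (cell v) us)))" if "2 * d \<le> n" for n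
  proof -
    have dn: "d < n" using that d by simp
    have fin: "finite (?L n)" by (rule finite_lists_length_eq[OF finite_ridges])
    have "real (card (stale_walks (ridges d n) (cell v) d (Suc k)))
        = (\<Sum>us\<in>?L n. of_bool (adjacent_walk d v us \<and> stale (cell v) us))" for v
    proof -
      have "stale_walks (ridges d n) (cell v) d (Suc k)
          = ?L n \<inter> {us. adjacent_walk d v us \<and> stale (cell v) us}"
        by (auto simp: stale_walks_def adjacent_walk_def)
      then show ?thesis using fin by simp
    qed
    then show ?thesis by (simp only: expectation_finite_sum[OF set_choice_pmf(1)[OF dn]])
  qed
  then show ?thesis using expectation_walk_bounds[OF d, of k] by fastforce
qed

theorem theorem1p8:
  fixes d :: nat and \<delta> :: real
  assumes "d \<ge> 2" and "\<delta> > 0"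
  shows "(\<lambda>n. measure_pmf.prob (random_one_out_complex d n)
                {K. real (homology_dim d K) > \<delta> * real n ^ d}) \<longlonglongrightarrow> 0"
proof -
  have d: "1 \<le> d" using assms by simp
  \<comment> \<open>Harmonic numbers diverge, so a fixed walk length brings the deterministic term
    of \<open>homology_dim_one_out_le\<close> below \<open>\<delta> / 2 * n ^ d\<close>.\<close>
  have "eventually (\<lambda>k. (harm k :: real) > 4 * ln (real (Suc d)) / \<delta>) sequentially"
    using harm_at_top by (simp add: filterlim_at_top_dense)
  then obtain k0 where k0: "\<And>k. k \<ge> k0 \<Longrightarrow> (harm k :: real) > 4 * ln (real (Suc d)) / \<delta>"
    by (auto simp: eventually_sequentially)
  \<comment> \<open>This is \<open>2 * k0 + 2\<close>: at least \<open>k0\<close>, and of the even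
    form in which the dimension bound is stated.\<close>
  define k where "k = Suc (2 * k0 + 1)"
  have hk: "2 * ln (real (Suc d)) / harm k \<le> \<delta> / 2"
  proof -
    have "(harm k :: real) > 0" by (simp add: k_def harm_pos)
    moreover have "(harm k :: real) > 4 * ln (real (Suc d)) / \<delta>" by (rule k0) (simp add: k_def)
    ultimately show ?thesis using assms(2) by (simp add: field_simps)
  qed
  obtain C where C: "C \<ge> 0" and EC: "\<And>n. 2 * d \<le> n \<Longrightarrow> measure_pmf.expectation (choice_pmf d n)
      (\<lambda>v. real (card (stale_walks (ridges d n) (cell v) d k)))
    \<le> C * real (card (ridges d n)) / real (n - d)"
    using expectation_stale_walks_le[OF d, of "2 * k0 + 1"] unfolding k_def by blast
  have bound: "measure_pmf.prob (random_one_out_complex d n)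
      {K. real (homology_dim d K) > \<delta> * real n ^ d} \<le> 4 * C / \<delta> * (1 / (real n - real d))"
    if n: "2 * d \<le> n" for n
  proof -
    let ?p = "choice_pmf d n" and ?N = "real (card (ridges d n))"
    let ?s = "\<lambda>v. real (card (stale_walks (ridges d n) (cell v) d k))"
    let ?A = "{v. real (homology_dim d (one_out_complex d n v)) > \<delta> * real n ^ d}"
    have dn: "d < n" using n d by simp
    have nd: "real n ^ d > 0" using dn by simp
    have N: "?N \<le> real n ^ d" using card_ridges_le[of d n] by (metis of_nat_le_iff of_nat_power)
    have "measure_pmf.prob (random_one_out_complex d n)
        {K. real (homology_dim d K) > \<delta> * real n ^ d} = measure_pmf.prob ?p ?A"
      by (simp add: random_one_out_complex_def choice_pmf_def ridges_def vimage_def)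
    also have "\<dots> = measure_pmf.expectation ?p (indicator ?A)" by simp
    \<comment> \<open>Markov's inequality, pointwise: when the dimension exceeds
      \<open>\<delta> * n ^ d\<close>, at least half of this must come from \<open>2 * ?s v\<close>,
      so \<open>4 * ?s v \<ge> \<delta> * n ^ d\<close>.\<close>
    also have "\<dots> \<le> measure_pmf.expectation ?p (\<lambda>v. 4 / (\<delta> * real n ^ d) * ?s v)"
    proof (rule expectation_finite_mono[OF set_choice_pmf(1)[OF dn]])
      fix v assume v: "v \<in> set_pmf ?p"
      show "indicator ?A v \<le> 4 / (\<delta> * real n ^ d) * ?s v"
      proof (cases "v \<in> ?A")
        case False
        then show ?thesis using assms(2) nd by simp
      next
        case True
        have "\<And>\<tau>. \<tau> \<in> ridges d n \<Longrightarrow> v \<tau> \<in> {1..n} - \<tau>" using set_choice_pmf(2)[OF dn v] .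
        from homology_dim_one_out_le[OF d, of n v k0] this
        have "real (homology_dim d (one_out_complex d n v))
            \<le> 2 * ?N * ln (real (Suc d)) / harm k + 2 * ?s v"
          by (simp add: k_def ridges_def cell_def[abs_def] del: of_nat_Suc)
        also have "2 * ?N * ln (real (Suc d)) / harm k = ?N * (2 * ln (real (Suc d)) / harm k)"
          by simp
        also have "\<dots> \<le> real n ^ d * (\<delta> / 2)"
          using N hk by (intro mult_mono) (auto simp: harm_nonneg)
        finally have "\<delta> * real n ^ d \<le> 4 * ?s v" using True by (simp add: algebra_simps)
        then show ?thesis using True assms(2) nd by (simp add: field_simps)
      qed
    qed
    also have "\<dots> = 4 / (\<delta> * real n ^ d) * measure_pmf.expectation ?p ?s" by simp
    also have "\<dots> \<le> 4 / (\<delta> * real n ^ d) * (C * ?N / real (n - d))"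
      using EC[OF n] assms(2) by (intro mult_left_mono) auto
    \<comment> \<open>There are at most \<open>n ^ d\<close> ridges, so this power cancels and a
      bound of order \<open>1 / n\<close> remains.\<close>
    also have "\<dots> \<le> 4 / (\<delta> * real n ^ d) * (C * real n ^ d / real (n - d))"
      using N C assms(2) by (intro mult_left_mono divide_right_mono) auto
    also have "\<dots> = 4 * C / \<delta> * (1 / (real n - real d))"
      using nd dn by (simp add: of_nat_diff)
    finally show ?thesis .
  qed
  have "(\<lambda>n. 4 * C / \<delta> * (1 / (real n - real d))) \<longlonglongrightarrow> 4 * C / \<delta> * 0"
    by (intro tendsto_mult tendsto_const) real_asymp
  then have lim: "(\<lambda>n. 4 * C / \<delta> * (1 / (real n - real d))) \<longlonglongrightarrow> 0" by simp
  show ?thesis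
  proof (rule tendsto_sandwich[OF _ _ tendsto_const lim])
    show "\<forall>\<^sub>F n in sequentially. measure_pmf.prob (random_one_out_complex d n)
        {K. real (homology_dim d K) > \<delta> * real n ^ d} \<le> 4 * C / \<delta> * (1 / (real n - real d))"
      using eventually_ge_at_top[of "2 * d"] by eventually_elim (rule bound)
  qed simp
qed

end
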